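(* Suppose that $\mathcal{R} = \langle R; <, +, \ldots\rangle$ is an expansion of a divisible ordered Abelian group, that $\mathcal{R}$ has burden $2$, that an infinite discrete subset of $R$ is definable in $\mathcal{R}$, and that there is also a definable $X \subseteq R$ which is dense and codense in some nonempty interval. Then the formula $\varphi(x;y)$ expressing that $x \in X - y$ (that is, $x + y \in X$) has the independence property.
   Context: Standing assumptions: the ordered group is densely ordered, and $\mathcal{R}$ is sufficiently saturated ($|T|^+$-saturated, where $T = \mathrm{Th}(\mathcal{R})$). "Definable" means definable in $\mathcal{R}$ with parameters. All topological notions refer to the order topology generated by open intervals. A set is discrete if each of its points is isolated in it. A set $X$ is dense and codense in a nonempty open interval $I$ if both $X \cap I$ and $I \setminus X$ are dense in $I$. An inp-pattern of depth $\kappa$ in a partial type $p(\overline{x})$ is a sequence of formulas $\{\varphi_i(\overline{x};\overline{y}_i) : i<\kappa\}$, a sequence of positive integers $\{k_i : i<\kappa\}$, and a sequence of tuples $\{\overline{a}_{i,j} : i<\kappa, j<\omega\}$ from some model of $T$ such that for each $i<\kappa$ the set $\{\varphi_i(\overline{x};\overline{a}_{i,j}) : j<\omega\}$ is $k_i$-inconsistent, and for each $\eta:\kappa\to\omega$ the set $p(\overline{x}) \cup \{\varphi_i(\overline{x};\overline{a}_{i,\eta(i)}) : i<\kappa\}$ is consistent. The partial type $p$ has burden less than $\kappa$ if there is no inp-pattern of depth $\kappa$ in $p$; its burden is $\lambda$ if the least $\kappa$ such that the burden of $p$ is less than $\kappa$ is $\lambda^+$. The burden of $\mathcal{R}$ (or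 of $T$) is the burden of the partial type $x=x$ in a single variable $x$. *)

theory Defs
  imports "HOL-Analysis.Isolated"
begin

section \<open>First-order logic\<close>

record ('f, 'r) lang =
  farity :: "'f \<Rightarrow> nat"
  rarity :: "'r \<Rightarrow> nat"

datatype 'f trm = Var nat | Fn 'f "'f trm list"

datatype ('f, 'r) fm =
    Eq "'f trm" "'f trm"
  | Rel 'r "'f trm list"
  | Neg "('f, 'r) fm"
  | Conj "('f, 'r) fm" "('f, 'r) fm"
  | Ex nat "('f, 'r) fm"

primrec wf_trm :: "('f, 'r) lang \<Rightarrow> 'f trm \<Rightarrow> bool" where
  "wf_trm L (Var i) \<longleftrightarrow> True"
| "wf_trm L (Fn f ts) \<longleftrightarrow> length ts = farity L f \<and> list_all id (map (wf_trm L) ts)"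

primrec wf_fm :: "('f, 'r) lang \<Rightarrow> ('f, 'r) fm \<Rightarrow> bool" where
  "wf_fm L (Eq s t) \<longleftrightarrow> wf_trm L s \<and> wf_trm L t"
| "wf_fm L (Rel r ts) \<longleftrightarrow> length ts = rarity L r \<and> list_all (wf_trm L) ts"
| "wf_fm L (Neg \<phi>) \<longleftrightarrow> wf_fm L \<phi>"
| "wf_fm L (Conj \<phi> \<psi>) \<longleftrightarrow> wf_fm L \<phi> \<and> wf_fm L \<psi>"
| "wf_fm L (Ex i \<phi>) \<longleftrightarrow> wf_fm L \<phi>"

primrec fv_trm :: "'f trm \<Rightarrow> nat set" where
  "fv_trm (Var i) = {i}"
| "fv_trm (Fn f ts) = \<Union> (set (map fv_trm ts))"

primrec fv :: "('f, 'r) fm \<Rightarrow> nat set" where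
  "fv (Eq s t) = fv_trm s \<union> fv_trm t"
| "fv (Rel r ts) = (\<Union>t\<in>set ts. fv_trm t)"
| "fv (Neg \<phi>) = fv \<phi>"
| "fv (Conj \<phi> \<psi>) = fv \<phi> \<union> fv \<psi>"
| "fv (Ex i \<phi>) = fv \<phi> - {i}"

text \<open>The \<open>L\<close>-formulas whose free variables are among the first \<open>n\<close> ones.\<close>

definition formulas :: "('f, 'r) lang \<Rightarrow> nat \<Rightarrow> ('f, 'r) fm set" where
  "formulas L n = {\<phi>. wf_fm L \<phi> \<and> fv \<phi> \<subseteq> {..<n}}"

record ('f, 'r, 'a) struct =
  univ :: "'a set"
  fint :: "'f \<Rightarrow> 'a list \<Rightarrow> 'a"
  rint :: "'r \<Rightarrow> 'a list \<Rightarrow> bool"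

definition tuples :: "'a set \<Rightarrow> nat \<Rightarrow> 'a list set" where
  "tuples A n = {xs. length xs = n \<and> set xs \<subseteq> A}"

text \<open>The values of \<open>fint\<close> and \<open>rint\<close> on lists of the wrong length, or on lists leaving the
  universe, are irrelevant: no well-formed formula ever evaluates them.\<close>

definition is_struct :: "('f, 'r) lang \<Rightarrow> ('f, 'r, 'a) struct \<Rightarrow> bool" where
  "is_struct L M \<longleftrightarrow>
     univ M \<noteq> {} \<and> (\<forall>f. \<forall>xs \<in> tuples (univ M) (farity L f). fint M f xs \<in> univ M)"

primrec eval_trm :: "('f, 'r, 'a) struct \<Rightarrow> (nat \<Rightarrow> 'a) \<Rightarrow> 'f trm \<Rightarrow> 'a" where
  "eval_trm M e (Var i) = e i"
| "eval_trm M e (Fn f ts) = fint M f (map (eval_trm M e) ts)"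

primrec sat :: "('f, 'r, 'a) struct \<Rightarrow> (nat \<Rightarrow> 'a) \<Rightarrow> ('f, 'r) fm \<Rightarrow> bool" where
  "sat M e (Eq s t) \<longleftrightarrow> eval_trm M e s = eval_trm M e t"
| "sat M e (Rel r ts) \<longleftrightarrow> rint M r (map (eval_trm M e) ts)"
| "sat M e (Neg \<phi>) \<longleftrightarrow> \<not> sat M e \<phi>"
| "sat M e (Conj \<phi> \<psi>) \<longleftrightarrow> sat M e \<phi> \<and> sat M e \<psi>"
| "sat M e (Ex i \<phi>) \<longleftrightarrow> (\<exists>x\<in>univ M. sat M (e(i := x)) \<phi>)"

text \<open>\<open>M \<Turnstile> \<phi>(xs)\<close>, the \<open>i\<close>-th variable being assigned the \<open>i\<close>-th entry of \<open>xs\<close>. It is only used for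
  \<open>\<phi> \<in> formulas L (length xs)\<close>, so the value of \<open>xs ! i\<close> for \<open>i \<ge> length xs\<close> plays no role.\<close>

definition holds :: "('f, 'r, 'a) struct \<Rightarrow> ('f, 'r) fm \<Rightarrow> 'a list \<Rightarrow> bool" where
  "holds M \<phi> xs \<longleftrightarrow> sat M (\<lambda>i. xs ! i) \<phi>"

definition Th :: "('f, 'r) lang \<Rightarrow> ('f, 'r, 'a) struct \<Rightarrow> ('f, 'r) fm set" where
  "Th L M = {\<sigma> \<in> formulas L 0. holds M \<sigma> []}"

definition is_model :: "('f, 'r) lang \<Rightarrow> ('f, 'r) fm set \<Rightarrow> ('f, 'r, 'a) struct \<Rightarrow> bool" where
  "is_model L T N \<longleftrightarrow> is_struct L N \<and> (\<forall>\<sigma>\<in>T. holds N \<sigma> [])"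

text \<open>A formula \<open>\<phi>(x\<^sub>1,\<dots>,x\<^sub>n; as)\<close> with parameters is a pair \<open>(\<phi>, as)\<close>: the object variables are the first
  \<open>n\<close> variables of \<open>\<phi>\<close>, and the parameters \<open>as\<close> are substituted for the following ones.\<close>

definition param_formulas ::
  "('f, 'r) lang \<Rightarrow> 'a set \<Rightarrow> nat \<Rightarrow> (('f, 'r) fm \<times> 'a list) set" where
  "param_formulas L A n = {(\<phi>, as). set as \<subseteq> A \<and> \<phi> \<in> formulas L (n + length as)}"

definition realizes ::
  "('f, 'r, 'a) struct \<Rightarrow> nat \<Rightarrow> 'a list \<Rightarrow> (('f, 'r) fm \<times> 'a list) set \<Rightarrow> bool" where
  "realizes M n xs p \<longleftrightarrow> xs \<in> tuples (univ M) n \<and> (\<forall>(\<phi>, as)\<in>p. holds M \<phi> (xs @ as))"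

text \<open>Consistency of a set of formulas in \<open>n\<close> variables with parameters in \<open>M\<close> (with the elementary
  diagram of \<open>M\<close>), that is, finite satisfiability in \<open>M\<close>.\<close>

definition consistent ::
  "('f, 'r, 'a) struct \<Rightarrow> nat \<Rightarrow> (('f, 'r) fm \<times> 'a list) set \<Rightarrow> bool" where
  "consistent M n p \<longleftrightarrow> (\<forall>q. finite q \<longrightarrow> q \<subseteq> p \<longrightarrow> (\<exists>xs. realizes M n xs q))"

definition saturated :: "('f, 'r) lang \<Rightarrow> ('f, 'r, 'a) struct \<Rightarrow> 'k rel \<Rightarrow> bool" where
  "saturated L M \<kappa> \<longleftrightarrow>
     (\<forall>A n p. A \<subseteq> univ M \<longrightarrow> (card_of A, \<kappa>) \<in> ordLess \<longrightarrow> p \<subseteq> param_formulas L A n \<longrightarrow>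
        consistent M n p \<longrightarrow> (\<exists>xs. realizes M n xs p))"

text \<open>The formula with parameters \<open>\<phi>(x\<^sub>1,\<dots>,x\<^sub>n; cs)\<close> defines the relation \<open>S\<close>.\<close>

definition defines_rel ::
  "('f, 'r) lang \<Rightarrow> ('f, 'r, 'a) struct \<Rightarrow> nat \<Rightarrow> ('f, 'r) fm \<Rightarrow> 'a list \<Rightarrow> 'a list set \<Rightarrow> bool" where
  "defines_rel L M n \<phi> cs S \<longleftrightarrow>
     (\<phi>, cs) \<in> param_formulas L (univ M) n \<and> S = {xs \<in> tuples (univ M) n. holds M \<phi> (xs @ cs)}"

definition definable :: "('f, 'r) lang \<Rightarrow> ('f, 'r, 'a) struct \<Rightarrow> nat \<Rightarrow> 'a list set \<Rightarrow> bool" where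
  "definable L M n S \<longleftrightarrow> (\<exists>\<phi> cs. defines_rel L M n \<phi> cs S)"

definition definable_set :: "('f, 'r) lang \<Rightarrow> ('f, 'r, 'a) struct \<Rightarrow> 'a set \<Rightarrow> bool" where
  "definable_set L M X \<longleftrightarrow> definable L M 1 ((\<lambda>x. [x]) ` X)"

section \<open>Burden and the independence property\<close>

text \<open>\<open>p\<close> is a partial type in \<open>n\<close> variables with parameters in \<open>N\<close>, the rows are indexed by \<open>I\<close>, and
  \<open>m i\<close> is the length of the parameter variable of \<open>\<phi> i\<close>. As usual, \<open>k\<close>-inconsistency of a row refers
  to the family indexed by \<open>j\<close>: any \<open>k\<close> of its members with distinct indices are jointly
  inconsistent.\<close>

definition inp_pattern ::
  "('f, 'r) lang \<Rightarrow> ('f, 'r, 'a) struct \<Rightarrow> nat \<Rightarrow> (('f, 'r) fm \<times> 'a list) set \<Rightarrow> 'i set \<Rightarrow>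
   ('i \<Rightarrow> ('f, 'r) fm) \<Rightarrow> ('i \<Rightarrow> nat) \<Rightarrow> ('i \<Rightarrow> nat) \<Rightarrow> ('i \<Rightarrow> nat \<Rightarrow> 'a list) \<Rightarrow> bool" where
  "inp_pattern L N n p I \<phi> m k a \<longleftrightarrow>
     (\<forall>i\<in>I. \<phi> i \<in> formulas L (n + m i) \<and> k i > 0 \<and> (\<forall>j. a i j \<in> tuples (univ N) (m i))) \<and>
     (\<forall>i\<in>I. \<forall>J. card J = k i \<longrightarrow> \<not> consistent N n {(\<phi> i, a i j) | j. j \<in> J}) \<and>
     (\<forall>\<eta> :: 'i \<Rightarrow> nat. consistent N n (p \<union> {(\<phi> i, a i (\<eta> i)) | i. i \<in> I}))"

text \<open>Burden of a partial type \<open>p \<subseteq> formulas L n\<close> without parameters, relative to the theory of \<open>M\<close>,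
  for finite depths \<open>\<kappa>\<close>. The models \<open>N\<close> of the theory range over those whose universe is a subset
  of the type of \<open>M\<close>. By the downward Loewenheim--Skolem theorem this is no restriction as soon
  as the universe of \<open>M\<close> has at least as many elements as there are \<open>L\<close>-formulas, hence in
  particular when \<open>M\<close> is infinite and \<open>|Th M|\<^sup>+\<close>-saturated.\<close>

definition burden_less ::
  "('f, 'r) lang \<Rightarrow> ('f, 'r, 'a) struct \<Rightarrow> nat \<Rightarrow> ('f, 'r) fm set \<Rightarrow> nat \<Rightarrow> bool" where
  "burden_less L M n p \<kappa> \<longleftrightarrow>
     \<not> (\<exists>(N :: ('f, 'r, 'a) struct) (\<phi> :: nat \<Rightarrow> ('f, 'r) fm) m k a.
          is_model L (Th L M) N \<and> inp_pattern L N n ((\<lambda>\<psi>. (\<psi>, [])) ` p) {..<\<kappa>} \<phi> m k a)"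

text \<open>The burden is the finite cardinal \<open>b\<close>: the least \<open>\<kappa>\<close> with burden less than \<open>\<kappa>\<close> is the successor
  cardinal \<open>b + 1\<close> of \<open>b\<close>.\<close>

definition burden_eq ::
  "('f, 'r) lang \<Rightarrow> ('f, 'r, 'a) struct \<Rightarrow> nat \<Rightarrow> ('f, 'r) fm set \<Rightarrow> nat \<Rightarrow> bool" where
  "burden_eq L M n p b \<longleftrightarrow> burden_less L M n p (Suc b) \<and> (\<forall>\<kappa> < Suc b. \<not> burden_less L M n p \<kappa>)"

definition struct_burden_eq :: "('f, 'r) lang \<Rightarrow> ('f, 'r, 'a) struct \<Rightarrow> nat \<Rightarrow> bool" where
  "struct_burden_eq L M b \<longleftrightarrow> burden_eq L M 1 {Eq (Var 0) (Var 0)} b"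

text \<open>The formula with parameters \<open>\<phi>(x;y)\<close>, with \<open>x\<close> the first \<open>n\<close> variables, \<open>y\<close> the next \<open>m\<close> ones and
  \<open>cs\<close> substituted for the remaining ones, has the independence property: it shatters sets of
  every finite size.\<close>

definition independence_property ::
  "('f, 'r, 'a) struct \<Rightarrow> nat \<Rightarrow> nat \<Rightarrow> ('f, 'r) fm \<Rightarrow> 'a list \<Rightarrow> bool" where
  "independence_property M n m \<phi> cs \<longleftrightarrow>
     (\<forall>l :: nat. \<exists>(a :: nat \<Rightarrow> 'a list) (b :: nat set \<Rightarrow> 'a list).
        (\<forall>i<l. a i \<in> tuples (univ M) n) \<and> (\<forall>S\<subseteq>{..<l}. b S \<in> tuples (univ M) m) \<and>
        (\<forall>i<l. \<forall>S\<subseteq>{..<l}. holds M \<phi> (a i @ b S @ cs) \<longleftrightarrow> i \<in> S))"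

section \<open>Expansions of ordered groups\<close>

text \<open>The ordered group is the type \<open>'a\<close>; the symbols \<open>lt\<close> and \<open>pl\<close> of \<open>L\<close> denote its order and its
  addition, and the interpretation of all other symbols is arbitrary.\<close>

definition expands_ordered_group ::
  "('f, 'r) lang \<Rightarrow> ('f, 'r, 'a::linordered_ab_group_add) struct \<Rightarrow> 'r \<Rightarrow> 'f \<Rightarrow> bool" where
  "expands_ordered_group L M lt pl \<longleftrightarrow>
     is_struct L M \<and> univ M = UNIV \<and>
     rarity L lt = 2 \<and> (\<forall>x y. rint M lt [x, y] \<longleftrightarrow> x < y) \<and>
     farity L pl = 2 \<and> (\<forall>x y. fint M pl [x, y] = x + y)"

definition divisible_group :: "'a::ab_group_add itself \<Rightarrow> bool" where
  "divisible_group _ \<longleftrightarrow> (\<forall>(x :: 'a) (n :: nat). n > 0 \<longrightarrow> (\<exists>y :: 'a. (\<Sum>i<n. y) = x))"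

definition dense_codense_in :: "'a::topological_space set \<Rightarrow> 'a set \<Rightarrow> bool" where
  "dense_codense_in X I \<longleftrightarrow> I \<subseteq> closure (X \<inter> I) \<and> I \<subseteq> closure (I - X)"

end

theory Submission
  imports Defs "HOL-Library.Ramsey"
begin

text \<open>
  As the burden is two, no three rows of one-variable formulas form an inp-pattern. The discrete set
  \<open>D\<close> always supplies one row, so that small balls behave as if they had burden one, and the
  aim is to find two rows inside a small ball.

  Saturation first replaces \<open>D\<close> by an infinite definable set whose points are uniformly separated,
  so that a ball of radius \<open>\<eta>\<close> contains at most one of them. Then every \<open>x\<close> near \<open>D\<close> is
  \<open>d + z\<close> with a unique \<open>d \<in> D\<close> and a small \<open>z\<close>, and \<open>d\<close> and \<open>z\<close> may be prescribed independently:
  one row picks \<open>d\<close>, and two rows about \<open>z\<close> would give depth three (\<open>no_two_rows_in_window\<close>). Two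
  consequences carry everything else. A definable nowhere dense subset \<open>N\<close> of a small ball is finite,
  since otherwise one row selects a point of \<open>N\<close> and another one the order of magnitude of the distance
  to \<open>N\<close> (\<open>nowhere_dense_finite\<close>). And no row can consist of sets that are all dense in a common
  small ball, because disjoint smaller balls form a second row (\<open>no_dense_row\<close>).

  Call two points equivalent if \<open>X\<close> has the same germ at both, that is, if translating one to the
  other maps \<open>X\<close> to \<open>X\<close> locally.

  If some equivalence class were infinite in the window, saturation would make the radius of
  agreement uniform on an infinite subset, which is then somewhere dense. The differences of its
  points are local periods of \<open>X\<close>, all valid on a fixed ball, and they are dense near \<open>0\<close>. They
  behave like a dense local subgroup. Divisible groups have no proper subgroup of finite index, and
  the local version of that fact says that if finitely many cosets covered a neighbourhood of \<open>0\<close>,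
  all small elements would be periods, whereas \<open>X\<close> is dense and codense. So there are
  infinitely many cosets, and these form a row of disjoint dense sets, which is impossible
  (\<open>finite_germ_classes\<close>).

  If on the other hand all classes are finite, then for any finitely many translates
  of \<open>X\<close> there is a further one whose germ differs from theirs at every point of some ball; this uses
  that finite sets cannot cover a ball of a saturated structure even countably often. Iterating and
  shrinking gives translates \<open>X + y\<^sub>0, X + y\<^sub>1, \<dots>\<close> such that all
  \<open>(X + y\<^sub>i) \<triangle> (X + y\<^sub>j)\<close> with \<open>i \<noteq> j\<close> are dense in one common ball. If
  translates of \<open>X\<close> failed to shatter some size \<open>m\<close>, a Ramsey argument would thin
  out the sequence so that no point lies in \<open>m\<close> of the sets
  \<open>(X + y\<^sub>2\<^sub>j) \<triangle> (X + y\<^sub>2\<^sub>j\<^sub>+\<^sub>1)\<close>. That would again be a row of dense sets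
  (\<open>shattering_if_finite_germ_classes\<close>), so \<open>x + y \<in> X\<close> shatters every finite size.
\<close>

section \<open>Distances in an ordered group\<close>

text \<open>A group of the given sort carries no absolute value operation, so \<open>\<bar>x - y\<bar> < r\<close> is spelled
  out with two strict inequalities; both are atomic formulas, which keeps the relation visibly definable.\<close>

definition near :: "'a::linordered_ab_group_add \<Rightarrow> 'a \<Rightarrow> 'a \<Rightarrow> bool" where
  "near r x y \<longleftrightarrow> x < y + r \<and> y < x + r"

lemma near_sym: "near r x y \<longleftrightarrow> near r y x"
  by (auto simp: near_def)

lemma near_refl [simp]: "near r x x \<longleftrightarrow> 0 < r"
  by (simp add: near_def)

lemma near_pos: "near r x y \<Longrightarrow> 0 < r"
proof (rule ccontr)
  assume "near r x y" and "\<not> 0 < r"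
  then have "y + r \<le> y" "x + r \<le> x" "x < y + r" "y < x + r" by (auto simp: near_def)
  then show False by (meson leD less_le_trans order.strict_trans)
qed

lemma near_mono: "near r x y \<Longrightarrow> r \<le> s \<Longrightarrow> near s x y"
  unfolding near_def by (meson add_left_mono less_le_trans)

lemma near_trans:
  assumes "near r x y" "near s y z" shows "near (r + s) x z"
proof -
  from assms have "x < y + r" "y < z + s" "z < y + s" "y < x + r" by (auto simp: near_def)
  from add_strict_mono[OF this(1,2)] add_strict_mono[OF this(3,4)] show ?thesis
    by (simp add: near_def algebra_simps)
qed

lemma near_add_right [simp]: "near r (x + t) (y + t) \<longleftrightarrow> near r x y"
  by (simp add: near_def algebra_simps)

lemma near_add_left [simp]: "near r (t + x) (t + y) \<longleftrightarrow> near r x y"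
  by (simp add: near_def algebra_simps)

lemma near_diff_left [simp]: "near r (t - x) (t - y) \<longleftrightarrow> near r x y"
  by (auto simp: near_def algebra_simps)

lemma near_diff_0: "near r (x - y) 0 \<longleftrightarrow> near r x y"
  by (auto simp: near_def algebra_simps)

lemma near_uminus_0: "near r (- x) 0 \<longleftrightarrow> near r x 0"
  using near_diff_left[of r 0 x 0] near_sym[of r x 0] by (simp add: near_sym)

lemma le_if_double_le:
  fixes x :: "'a::linordered_ab_group_add"
  assumes "0 < x" "x + x \<le> y" shows "x \<le> y"
proof -
  have "x \<le> x + x" using assms(1) by simp
  then show ?thesis using assms(2) by (rule order_trans)
qed

lemma near_add:
  assumes "near r x 0" "near s y 0" shows "near (r + s) (x + y) 0"
  using near_trans[of s "x + y" x r 0] near_add_left[of s x y 0] assms by (simp add: add.commute)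

lemma near_diff:
  assumes "near r x 0" "near s y 0" shows "near (r + s) (x - y) 0"
  using near_add[OF assms(1), of s "- y"] assms(2) near_uminus_0[of s y] by simp

lemma ex_half:
  fixes r :: "'a::{linordered_ab_group_add, dense_linorder}"
  assumes "0 < r" shows "\<exists>s>0. s + s \<le> r"
proof -
  obtain a where a: "0 < a" "a < r" using assms dense by blast
  have "min a (r - a) + min a (r - a) \<le> a + (r - a)" by (intro add_mono) auto
  moreover have "min a (r - a) > 0" using a by simp
  ultimately show ?thesis by (intro exI[of _ "min a (r - a)"]) simp
qed

lemma near_interior:
  assumes "near r x y" shows "\<exists>s>0. \<forall>z. near s z x \<longrightarrow> near r z y"
proof (intro exI[of _ "min (y + r - x) (x + r - y)"] conjI allI impI)
  let ?s = "min (y + r - x) (x + r - y)"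
  show "0 < ?s" using assms by (simp add: near_def)
  fix z assume z: "near ?s z x"
  have "z < x + ?s" using z by (simp add: near_def)
  also have "\<dots> \<le> x + (y + r - x)" by (intro add_left_mono) simp
  finally have 1: "z < y + r" by simp
  have "x < z + ?s" using z by (simp add: near_def)
  also have "\<dots> \<le> z + (x + r - y)" by (intro add_left_mono) simp
  finally have "y < z + r" by (simp add: algebra_simps)
  with 1 show "near r z y" by (simp add: near_def)
qed

lemma infinite_ball:
  fixes r :: "'a::{linordered_ab_group_add, dense_linorder}"
  assumes "0 < r" shows "infinite {x. near r x c}"
proof -
  have "{c<..<c + r} \<subseteq> {x. near r x c}"
    using assms by (auto simp: near_def) (meson add_strict_increasing less_imp_le less_trans add_less_cancel_left add_strict_increasing2 le_less_trans less_add_same_cancel1)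
  moreover have "infinite {c<..<c + r}" using assms by (intro infinite_Ioo) simp
  ultimately show ?thesis using finite_subset by blast
qed

definition dense_in :: "'a::linordered_ab_group_add set \<Rightarrow> 'a \<Rightarrow> 'a \<Rightarrow> bool" where
  "dense_in N c r \<longleftrightarrow> (\<forall>x s. near r x c \<longrightarrow> 0 < s \<longrightarrow> (\<exists>y\<in>N. near s y x))"

text \<open>Balls take the place of open intervals: density and nowhere density are then invariant under
  translation by the same simple rewrite rules as \<open>near\<close>.\<close>

definition nowhere_dense :: "'a::linordered_ab_group_add set \<Rightarrow> bool" where
  "nowhere_dense N \<longleftrightarrow>
     (\<forall>c r. 0 < r \<longrightarrow> (\<exists>x s. 0 < s \<and> (\<forall>z. near s z x \<longrightarrow> near r z c \<and> z \<notin> N)))"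

lemma not_nowhere_denseD:
  fixes N :: "'a::linordered_ab_group_add set"
  assumes "\<not> nowhere_dense N" obtains c r where "0 < r" "dense_in N c r"
proof -
  from assms obtain c r where r: "0 < r"
    "\<And>x s. 0 < s \<Longrightarrow> \<exists>z. near s z x \<and> (near r z c \<longrightarrow> z \<in> N)"
    unfolding nowhere_dense_def by blast
  have "dense_in N c r" unfolding dense_in_def
  proof (intro allI impI)
    fix x s :: 'a assume x: "near r x c" and s: "0 < s"
    from near_interior[OF x] obtain s' where s': "0 < s'" "\<And>z. near s' z x \<Longrightarrow> near r z c" by blast
    from r(2)[of "min s s'" x] s s'(1) obtain z where
      "near (min s s') z x" "near r z c \<longrightarrow> z \<in> N" by auto
    then show "\<exists>y\<in>N. near s y x"
      using s'(2) near_mono[of "min s s'" z x] by (meson min.cobounded1 min.cobounded2)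
  qed
  with r(1) show ?thesis by (rule that)
qed

section \<open>Multiples of a group element\<close>

text \<open>The same sum as in \<open>divisible_group\<close>, so that divisibility reads \<open>\<exists>y. multiple n y = x\<close>.\<close>

definition multiple :: "nat \<Rightarrow> 'a::ab_group_add \<Rightarrow> 'a" where
  "multiple n x = (\<Sum>i<n. x)"

lemma multiple_0 [simp]: "multiple 0 x = 0"
  by (simp add: multiple_def)

lemma multiple_Suc [simp]: "multiple (Suc n) x = multiple n x + x"
  by (simp add: multiple_def)

lemma multiple_add: "multiple (m + n) x = multiple m x + multiple n x"
  by (induction n) (simp_all add: algebra_simps)

lemma multiple_mult: "multiple (m * n) x = multiple m (multiple n x)"
  by (induction m) (simp_all add: multiple_add algebra_simps)

lemma near_multiple_mono:
  fixes x :: "'a::linordered_ab_group_add"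
  assumes "near r (multiple n x) 0" "k \<le> n" shows "near r (multiple k x) 0"
proof (cases "0 \<le> x")
  case True
  have "multiple j x \<le> multiple (Suc j) x" for j using True by simp
  then have "multiple k x \<le> multiple n x" "multiple 0 x \<le> multiple k x"
    using lift_Suc_mono_le[of "\<lambda>j. multiple j x"] assms(2) by blast+
  then have "multiple k x < r" "0 \<le> multiple k x" using assms(1) by (auto simp: near_def)
  moreover have "0 < r" using assms(1) by (rule near_pos)
  ultimately show ?thesis by (simp add: near_def add_nonneg_pos)
next
  case False
  then have "multiple (Suc j) x \<le> multiple j x" for j by simp
  then have "multiple n x \<le> multiple k x" "multiple k x \<le> multiple 0 x"
    using lift_Suc_antimono_le[of "\<lambda>j. multiple j x"] assms(2) by blast+
  then have "multiple k x \<le> 0" "0 < multiple k x + r"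
    using assms(1) by (auto simp: near_def) (meson add_right_mono less_le_trans)
  moreover have "0 < r" using assms(1) by (rule near_pos)
  ultimately show ?thesis by (simp add: near_def)
qed

section \<open>Renaming of variables\<close>

lemma finite_fv_trm: "finite (fv_trm t)"
  by (induction t) auto

lemma finite_fv: "finite (fv \<phi>)"
  by (induction \<phi>) (auto simp: finite_fv_trm)

lemma eval_trm_cong:
  "(\<And>i. i \<in> fv_trm t \<Longrightarrow> e i = e' i) \<Longrightarrow> eval_trm M e t = eval_trm M e' t"
proof (induction t)
  case (Fn f ts)
  have "map (eval_trm M e) ts = map (eval_trm M e') ts"
    using Fn by (intro map_cong) auto
  then show ?case by (simp only: eval_trm.simps)
qed auto

lemma sat_cong:
  "(\<And>i. i \<in> fv \<phi> \<Longrightarrow> e i = e' i) \<Longrightarrow> sat M e \<phi> \<longleftrightarrow> sat M e' \<phi>"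
proof (induction \<phi> arbitrary: e e')
  case (Eq s t)
  then have "eval_trm M e s = eval_trm M e' s" "eval_trm M e t = eval_trm M e' t"
    by (auto intro: eval_trm_cong)
  then show ?case by simp
next
  case (Rel r ts)
  have "map (eval_trm M e) ts = map (eval_trm M e') ts"
    using Rel by (intro map_cong) (auto intro: eval_trm_cong)
  then show ?case by (simp only: sat.simps)
next
  case (Neg \<phi>)
  then show ?case by (metis fv.simps(3) sat.simps(3))
next
  case (Conj \<phi> \<psi>)
  have "sat M e \<phi> = sat M e' \<phi>" "sat M e \<psi> = sat M e' \<psi>"
    using Conj.prems by (auto intro!: Conj.IH)
  then show ?case by simp
next
  case (Ex j \<phi>)
  have "sat M (e(j := x)) \<phi> = sat M (e'(j := x)) \<phi>" for x
    by (rule Ex.IH) (use Ex.prems in auto)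
  then show ?case by simp
qed

primrec rename_trm :: "(nat \<Rightarrow> nat) \<Rightarrow> 'f trm \<Rightarrow> 'f trm" where
  "rename_trm \<sigma> (Var i) = Var (\<sigma> i)"
| "rename_trm \<sigma> (Fn f ts) = Fn f (map (rename_trm \<sigma>) ts)"

lemma wf_rename_trm: "wf_trm L (rename_trm \<sigma> t) \<longleftrightarrow> wf_trm L t"
  by (induction t) (auto simp: list_all_iff)

lemma fv_rename_trm: "fv_trm (rename_trm \<sigma> t) = \<sigma> ` fv_trm t"
  by (induction t) auto

lemma eval_rename_trm: "eval_trm M e (rename_trm \<sigma> t) = eval_trm M (\<lambda>i. e (\<sigma> i)) t"
proof (induction t)
  case (Fn f ts)
  then have "map (\<lambda>t. eval_trm M e (rename_trm \<sigma> t)) ts = map (eval_trm M (\<lambda>i. e (\<sigma> i))) ts"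
    by (intro map_cong) auto
  then show ?case by (simp add: comp_def cong: map_cong)
qed auto

text \<open>A bound variable may capture the new name of a free one, so the renaming is also changed at
  every quantifier, where the bound variable receives a name outside the range in use.\<close>

lemma ex_renamed_formula:
  "wf_fm L \<phi> \<Longrightarrow> \<exists>\<phi>'. wf_fm L \<phi>' \<and> fv \<phi>' \<subseteq> \<sigma> ` fv \<phi> \<and> (\<forall>e. sat M e \<phi>' \<longleftrightarrow> sat M (\<lambda>i. e (\<sigma> i)) \<phi>)"
proof (induction \<phi> arbitrary: \<sigma>)
  case (Eq s t)
  show ?case
    by (rule exI[of _ "Eq (rename_trm \<sigma> s) (rename_trm \<sigma> t)"])
      (use Eq in \<open>auto simp: wf_rename_trm fv_rename_trm eval_rename_trm\<close>)
next
  case (Rel r ts)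
  show ?case
    using Rel by (intro exI[of _ "Rel r (map (rename_trm \<sigma>) ts)"])
      (auto simp: wf_rename_trm fv_rename_trm eval_rename_trm list_all_iff comp_def)
next
  case (Neg \<phi>)
  then obtain \<phi>' where "wf_fm L \<phi>'" "fv \<phi>' \<subseteq> \<sigma> ` fv \<phi>" "\<forall>e. sat M e \<phi>' \<longleftrightarrow> sat M (\<lambda>i. e (\<sigma> i)) \<phi>"
    by (metis wf_fm.simps(3))
  then show ?case by (intro exI[of _ "Neg \<phi>'"]) auto
next
  case (Conj \<phi> \<psi>)
  from Conj.prems have "wf_fm L \<phi>" "wf_fm L \<psi>" by auto
  from Conj.IH(1)[OF this(1), of \<sigma>] Conj.IH(2)[OF this(2), of \<sigma>]
  obtain \<phi>' \<psi>' where "wf_fm L \<phi>'" "fv \<phi>' \<subseteq> \<sigma> ` fv \<phi>" "\<forall>e. sat M e \<phi>' \<longleftrightarrow> sat M (\<lambda>i. e (\<sigma> i)) \<phi>"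
    "wf_fm L \<psi>'" "fv \<psi>' \<subseteq> \<sigma> ` fv \<psi>" "\<forall>e. sat M e \<psi>' \<longleftrightarrow> sat M (\<lambda>i. e (\<sigma> i)) \<psi>"
    by auto
  then show ?case by (intro exI[of _ "Conj \<phi>' \<psi>'"]) auto
next
  case (Ex i \<phi>)
  have "finite (\<sigma> ` fv \<phi>)" by (simp add: finite_fv)
  then obtain k where k: "k \<notin> \<sigma> ` fv \<phi>"
    using ex_new_if_finite infinite_UNIV_nat by blast
  have "wf_fm L \<phi>" using Ex.prems by simp
  from Ex.IH[OF this, of "\<sigma>(i := k)"] obtain \<phi>' where
    *: "wf_fm L \<phi>'" "fv \<phi>' \<subseteq> (\<sigma>(i := k)) ` fv \<phi>" "\<And>e. sat M e \<phi>' \<longleftrightarrow> sat M (\<lambda>n. e ((\<sigma>(i := k)) n)) \<phi>"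
    by auto
  have "sat M (\<lambda>n. (e(k := x)) ((\<sigma>(i := k)) n)) \<phi> \<longleftrightarrow> sat M ((\<lambda>n. e (\<sigma> n))(i := x)) \<phi>" for e x
    by (rule sat_cong) (use k in auto)
  moreover have "fv (Ex k \<phi>') \<subseteq> \<sigma> ` fv (Ex i \<phi>)"
    using *(2) by auto
  ultimately show ?case using * by (intro exI[of _ "Ex k \<phi>'"]) auto
qed

section \<open>Predicates definable with parameters\<close>

text \<open>Definability is handled semantically, for predicates of an environment \<open>e\<close> that assigns values to
  countably many variables. A formula has infinitely many variables at its disposal as well, so the even
  ones carry \<open>e\<close> and the odd ones the parameters. Two formulas are given common parameters by
  interleaving these.

  Quantifiers use the de Bruijn convention: under a quantifier, \<open>e 0\<close> is the bound variable and
  \<open>e (Suc i)\<close> the former \<open>e i\<close>. All closure rules then have higher-order patterns as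
  conclusions, and definability of a concrete predicate is proved by resolution with \<open>definable_intros\<close>.\<close>

locale ordered_group_structure =
  fixes L :: "('f, 'r) lang"
    and R :: "('f, 'r, 'a::{linordered_ab_group_add, linorder_topology, dense_linorder}) struct"
    and lt :: 'r and pl :: 'f
  assumes expands: "expands_ordered_group L R lt pl"
begin

lemma univ_R [simp]: "univ R = UNIV"
  using expands by (simp add: expands_ordered_group_def)

definition mix :: "(nat \<Rightarrow> 'a) \<Rightarrow> (nat \<Rightarrow> 'a) \<Rightarrow> nat \<Rightarrow> 'a" where
  "mix e c n = (if even n then e (n div 2) else c (n div 2))"

definition definable_pred :: "((nat \<Rightarrow> 'a) \<Rightarrow> bool) \<Rightarrow> bool" where
  "definable_pred P \<longleftrightarrow> (\<exists>\<phi> c. wf_fm L \<phi> \<and> (\<forall>e. P e \<longleftrightarrow> sat R (mix e c) \<phi>))"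

definition definable_fun :: "((nat \<Rightarrow> 'a) \<Rightarrow> 'a) \<Rightarrow> bool" where
  "definable_fun f \<longleftrightarrow> definable_pred (\<lambda>e. e 0 = f (\<lambda>i. e (Suc i)))"

lemma definable_predI_rename:
  assumes "wf_fm L \<phi>" "\<And>e n. n \<in> fv \<phi> \<Longrightarrow> mix e c (\<sigma> n) = g e n"
    and "\<And>e. P e \<longleftrightarrow> sat R (g e) \<phi>"
  shows "definable_pred P"
proof -
  from ex_renamed_formula[OF assms(1), of \<sigma> R] obtain \<phi>' where
    *: "wf_fm L \<phi>'" "\<And>e. sat R e \<phi>' \<longleftrightarrow> sat R (\<lambda>i. e (\<sigma> i)) \<phi>" by auto
  have "sat R (\<lambda>i. mix e c (\<sigma> i)) \<phi> \<longleftrightarrow> sat R (g e) \<phi>" for e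
    by (rule sat_cong) (use assms(2) in auto)
  with * assms(3) show ?thesis unfolding definable_pred_def by (intro exI[of _ \<phi>'] exI[of _ c]) simp
qed

lemma definable_neg: "definable_pred P \<Longrightarrow> definable_pred (\<lambda>e. \<not> P e)"
  unfolding definable_pred_def by (metis sat.simps(3) wf_fm.simps(3))

lemma common_parameters:
  assumes "definable_pred P" "definable_pred Q"
  obtains \<phi> \<psi> c where "wf_fm L \<phi>" "wf_fm L \<psi>" "\<And>e. P e \<longleftrightarrow> sat R (mix e c) \<phi>"
    "\<And>e. Q e \<longleftrightarrow> sat R (mix e c) \<psi>"
proof -
  from assms obtain \<phi> c \<psi> d where 1: "wf_fm L \<phi>" "\<And>e. P e \<longleftrightarrow> sat R (mix e c) \<phi>"
    and 2: "wf_fm L \<psi>" "\<And>e. Q e \<longleftrightarrow> sat R (mix e d) \<psi>" unfolding definable_pred_def by metis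
  \<comment> \<open>parameter variables \<open>2k + 1\<close> are moved to \<open>4k + 1\<close> and \<open>4k + 3\<close>, respectively\<close>
  define \<sigma> \<tau> :: "nat \<Rightarrow> nat" where
    "\<sigma> = (\<lambda>n. if even n then n else 4 * (n div 2) + 1)" and
    "\<tau> = (\<lambda>n. if even n then n else 4 * (n div 2) + 3)"
  define cd where "cd = (\<lambda>k. if even k then c (k div 2) else d (k div 2))"
  have cd: "cd (2 * k) = c k" "cd (Suc (2 * k)) = d k" for k by (auto simp: cd_def)
  have div: "(4 * k + 1) div 2 = 2 * k" "(4 * k + 3) div 2 = Suc (2 * k)" for k :: nat
    by presburger+
  have \<sigma>: "(\<lambda>i. mix e cd (\<sigma> i)) = mix e c" for e
  proof
    fix n show "mix e cd (\<sigma> n) = mix e c n"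
    proof (cases "even n")
      case False
      then obtain k where "n = 2 * k + 1" by (elim oddE)
      then show ?thesis by (simp add: mix_def \<sigma>_def div cd)
    qed (simp add: mix_def \<sigma>_def)
  qed
  have \<tau>: "(\<lambda>i. mix e cd (\<tau> i)) = mix e d" for e
  proof
    fix n show "mix e cd (\<tau> n) = mix e d n"
    proof (cases "even n")
      case False
      then obtain k where "n = 2 * k + 1" by (elim oddE)
      then show ?thesis by (simp add: mix_def \<tau>_def div cd)
    qed (simp add: mix_def \<tau>_def)
  qed
  obtain \<phi>' where "wf_fm L \<phi>'" "\<And>e. sat R e \<phi>' \<longleftrightarrow> sat R (\<lambda>i. e (\<sigma> i)) \<phi>"
    using ex_renamed_formula[OF 1(1), of \<sigma> R] by auto
  moreover obtain \<psi>' where "wf_fm L \<psi>'" "\<And>e. sat R e \<psi>' \<longleftrightarrow> sat R (\<lambda>i. e (\<tau> i)) \<psi>"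
    using ex_renamed_formula[OF 2(1), of \<tau> R] by auto
  ultimately show ?thesis using 1 2 \<sigma> \<tau> by (intro that[of \<phi>' \<psi>' cd]) auto
qed

lemma definable_conj: assumes "definable_pred P" "definable_pred Q" shows "definable_pred (\<lambda>e. P e \<and> Q e)"
proof -
  from common_parameters[OF assms] obtain \<phi> \<psi> c where "wf_fm L \<phi>" "wf_fm L \<psi>"
    "\<And>e. P e \<longleftrightarrow> sat R (mix e c) \<phi>" "\<And>e. Q e \<longleftrightarrow> sat R (mix e c) \<psi>" by metis
  then show ?thesis unfolding definable_pred_def by (intro exI[of _ "Conj \<phi> \<psi>"] exI[of _ c]) auto
qed

lemma definable_ex: assumes "definable_pred (\<lambda>e. P (\<lambda>i. e (Suc i)) (e 0))" shows "definable_pred (\<lambda>e. \<exists>x. P e x)"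
proof -
  from assms obtain \<phi> c where \<phi>: "wf_fm L \<phi>"
    "\<And>e. P (\<lambda>i. e (Suc i)) (e 0) \<longleftrightarrow> sat R (mix e c) \<phi>" unfolding definable_pred_def by metis
  have "finite ((\<lambda>k. k div 2) ` fv \<phi>)" by (simp add: finite_fv)
  then obtain K where "K \<notin> (\<lambda>k. k div 2) ` fv \<phi>"
    using ex_new_if_finite infinite_UNIV_nat by blast
  then have K: "2 * K + 1 \<notin> fv \<phi>" by force
  define \<sigma> where "\<sigma> n = (if n = 0 then 2 * K + 1 else if even n then n - 2 else n)" for n
  obtain \<phi>' where \<phi>': "wf_fm L \<phi>'" "\<And>e. sat R e \<phi>' \<longleftrightarrow> sat R (\<lambda>i. e (\<sigma> i)) \<phi>"
    using ex_renamed_formula[OF \<phi>(1), of \<sigma> R] by auto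
  have "P e x \<longleftrightarrow> sat R ((mix e c)(2 * K + 1 := x)) \<phi>'" for e x
  proof -
    have "sat R (\<lambda>n. ((mix e c)(2 * K + 1 := x)) (\<sigma> n)) \<phi> \<longleftrightarrow> sat R (mix (case_nat x e) c) \<phi>"
    proof (rule sat_cong)
      fix n assume n: "n \<in> fv \<phi>"
      consider "n = 0" | m where "n = 2 * Suc m" | "odd n" "n \<noteq> 2 * K + 1"
        using n K by (metis dvd_def not0_implies_Suc mult_0_right)
      then show "((mix e c)(2 * K + 1 := x)) (\<sigma> n) = mix (case_nat x e) c n"
      proof cases
        case 2
        have "2 * m \<noteq> 2 * K + 1" by presburger
        then show ?thesis using 2 by (simp add: \<sigma>_def mix_def)
      qed (auto simp: \<sigma>_def mix_def)
    qed
    then show ?thesis using \<phi>(2)[of "case_nat x e"] \<phi>'(2) by simp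
  qed
  with \<phi>' show ?thesis unfolding definable_pred_def by (intro exI[of _ "Ex (2 * K + 1) \<phi>'"] exI[of _ c]) auto
qed

lemma definable_reindex: assumes "definable_pred P" shows "definable_pred (\<lambda>e. P (\<lambda>i. e (\<tau> i)))"
proof -
  from assms obtain \<phi> c where \<phi>: "wf_fm L \<phi>" "\<And>e. P e \<longleftrightarrow> sat R (mix e c) \<phi>"
    unfolding definable_pred_def by metis
  show ?thesis
    by (rule definable_predI_rename[where c = c and g = "\<lambda>e. mix (\<lambda>i. e (\<tau> i)) c"
          and \<sigma> = "\<lambda>n. if even n then 2 * \<tau> (n div 2) else n", OF \<phi>(1)])
      (auto simp: mix_def \<phi>(2))
qed

text \<open>Substitution of a definable function for a variable, expressed by quantifying over its value.\<close>

lemma definable_bind: assumes "definable_fun f" "definable_pred P" shows "definable_pred (\<lambda>e. P (case_nat (f e) e))"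
proof -
  have "case_nat (e 0) (\<lambda>i. e (Suc i)) = e" for e :: "nat \<Rightarrow> 'a"
    by (auto simp: fun_eq_iff split: nat.split)
  then have "definable_pred (\<lambda>e. e 0 = f (\<lambda>i. e (Suc i)) \<and> P (case_nat (e 0) (\<lambda>i. e (Suc i))))"
    using assms by (auto simp: definable_fun_def intro: definable_conj)
  from definable_ex[where P = "\<lambda>e x. x = f e \<and> P (case_nat x e)", OF this] show ?thesis by simp
qed

lemma definable_fun_weaken: "definable_fun f \<Longrightarrow> definable_fun (\<lambda>e. f (\<lambda>i. e (Suc i)))"
  unfolding definable_fun_def
  by (drule definable_reindex[where \<tau> = "case_nat 0 (\<lambda>i. Suc (Suc i))"]) simp

lemma definable_app1: "definable_pred (\<lambda>e. A (e 0)) \<Longrightarrow> definable_fun f \<Longrightarrow> definable_pred (\<lambda>e. A (f e))"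
  using definable_bind[of f "\<lambda>e. A (e 0)"] by simp

lemma definable_app2:
  assumes "definable_pred (\<lambda>e. A (e 0) (e 1))" "definable_fun f" "definable_fun g" shows "definable_pred (\<lambda>e. A (f e) (g e))"
proof -
  have "definable_pred (\<lambda>e. A (f (\<lambda>i. e (Suc i))) (e 0))"
    using definable_bind[OF definable_fun_weaken[OF assms(2)] assms(1)] by simp
  from definable_bind[OF assms(3) this] show ?thesis by simp
qed

lemma definable_app3:
  assumes "definable_pred (\<lambda>e. A (e 0) (e 1) (e 2))" "definable_fun f" "definable_fun g" "definable_fun h"
  shows "definable_pred (\<lambda>e. A (f e) (g e) (h e))"
proof -
  have "definable_pred (\<lambda>e. A (f (\<lambda>i. e (Suc (Suc i)))) (e 0) (e 1))"
    using definable_bind[OF definable_fun_weaken[OF definable_fun_weaken[OF assms(2)]] assms(1)] 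
    by (simp add: numeral_2_eq_2)
  from definable_bind[OF definable_fun_weaken[OF assms(3)] this]
  have "definable_pred (\<lambda>e. A (f (\<lambda>i. e (Suc i))) (g (\<lambda>i. e (Suc i))) (e 0))" by simp
  from definable_bind[OF assms(4) this] show ?thesis by simp
qed

lemma definable_disj: assumes "definable_pred P" "definable_pred Q" shows "definable_pred (\<lambda>e. P e \<or> Q e)"
proof -
  have "definable_pred (\<lambda>e. \<not> (\<not> P e \<and> \<not> Q e))"
    by (rule definable_neg[OF definable_conj[OF definable_neg[OF assms(1)] definable_neg[OF assms(2)]]])
  then show ?thesis by simp
qed

lemma definable_imp: assumes "definable_pred P" "definable_pred Q" shows "definable_pred (\<lambda>e. P e \<longrightarrow> Q e)"
proof -
  have "definable_pred (\<lambda>e. \<not> P e \<or> Q e)"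
    by (rule definable_disj[OF definable_neg[OF assms(1)] assms(2)])
  then show ?thesis by simp
qed

lemma definable_iff: assumes "definable_pred P" "definable_pred Q" shows "definable_pred (\<lambda>e. P e \<longleftrightarrow> Q e)"
proof -
  have "definable_pred (\<lambda>e. (P e \<longrightarrow> Q e) \<and> (Q e \<longrightarrow> P e))"
    by (rule definable_conj[OF definable_imp[OF assms] definable_imp[OF assms(2,1)]])
  moreover have "(\<lambda>e. (P e \<longrightarrow> Q e) \<and> (Q e \<longrightarrow> P e)) = (\<lambda>e. P e \<longleftrightarrow> Q e)" by blast
  ultimately show ?thesis by simp
qed

lemma definable_all: assumes "definable_pred (\<lambda>e. P (\<lambda>i. e (Suc i)) (e 0))" shows "definable_pred (\<lambda>e. \<forall>x. P e x)"
proof -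
  have "definable_pred (\<lambda>e. \<not> (\<exists>x. \<not> P e x))"
    by (intro definable_neg definable_ex assms)
  then show ?thesis by simp
qed

lemma definable_bex:
  assumes "definable_pred (\<lambda>e. e 0 \<in> A)" "definable_pred (\<lambda>e. P (\<lambda>i. e (Suc i)) (e 0))" shows "definable_pred (\<lambda>e. \<exists>x\<in>A. P e x)"
proof -
  have "definable_pred (\<lambda>e. \<exists>x. x \<in> A \<and> P e x)"
    by (intro definable_ex definable_conj assms)
  then show ?thesis by (simp add: Bex_def)
qed

lemma definable_ball:
  assumes "definable_pred (\<lambda>e. e 0 \<in> A)" "definable_pred (\<lambda>e. P (\<lambda>i. e (Suc i)) (e 0))" shows "definable_pred (\<lambda>e. \<forall>x\<in>A. P e x)"
proof -
  have "definable_pred (\<lambda>e. \<forall>x. x \<in> A \<longrightarrow> P e x)"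
    by (intro definable_all definable_imp assms)
  then show ?thesis by (simp add: Ball_def)
qed

lemma definable_fun_var: "definable_fun (\<lambda>e. e i)"
  unfolding definable_fun_def definable_pred_def
  by (rule exI[of _ "Eq (Var 0) (Var (2 * Suc i))"], rule exI[of _ "\<lambda>_. undefined"])
    (simp add: mix_def)

lemma definable_fun_const: "definable_fun (\<lambda>e. a)"
  unfolding definable_fun_def definable_pred_def
  by (rule exI[of _ "Eq (Var 0) (Var 1)"], rule exI[of _ "\<lambda>_. a"])
    (simp add: mix_def)

lemma definable_eq: "definable_fun f \<Longrightarrow> definable_fun g \<Longrightarrow> definable_pred (\<lambda>e. f e = g e)"
proof (rule definable_app2)
  show "definable_pred (\<lambda>e. e 0 = e 1)"
    unfolding definable_pred_def
    by (rule exI[of _ "Eq (Var 0) (Var 2)"], rule exI[of _ "\<lambda>_. undefined"])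
      (simp add: mix_def)
qed

lemma definable_less: "definable_fun f \<Longrightarrow> definable_fun g \<Longrightarrow> definable_pred (\<lambda>e. f e < g e)"
proof (rule definable_app2)
  show "definable_pred (\<lambda>e. e 0 < e 1)"
    unfolding definable_pred_def
    by (rule exI[of _ "Rel lt [Var 0, Var 2]"], rule exI[of _ "\<lambda>_. undefined"])
      (use expands in \<open>simp add: mix_def expands_ordered_group_def\<close>)
qed

lemma definable_le: assumes "definable_fun f" "definable_fun g" shows "definable_pred (\<lambda>e. f e \<le> g e)"
proof -
  have "definable_pred (\<lambda>e. \<not> g e < f e)"
    by (intro definable_neg definable_less assms)
  then show ?thesis by (simp add: not_less)
qed

lemma definable_fun_graph2:
  assumes "definable_pred (\<lambda>e. e 0 = F (e 1) (e 2))" "definable_fun f" "definable_fun g"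
  shows "definable_fun (\<lambda>e. F (f e) (g e))"
  unfolding definable_fun_def
  using definable_app3[where A = "\<lambda>x y z. x = F y z", OF assms(1) definable_fun_var[of 0]
      definable_fun_weaken[OF assms(2)] definable_fun_weaken[OF assms(3)]] .

lemma definable_fun_add: "definable_fun f \<Longrightarrow> definable_fun g \<Longrightarrow> definable_fun (\<lambda>e. f e + g e)"
proof (rule definable_fun_graph2[where F = "(+)" and f = f and g = g])
  show "definable_pred (\<lambda>e. e 0 = e 1 + e 2)"
    unfolding definable_pred_def
    by (rule exI[of _ "Eq (Var 0) (Fn pl [Var 2, Var 4])"], rule exI[of _ "\<lambda>_. undefined"])
      (use expands in \<open>simp add: mix_def expands_ordered_group_def\<close>)
qed

lemma definable_fun_diff: "definable_fun f \<Longrightarrow> definable_fun g \<Longrightarrow> definable_fun (\<lambda>e. f e - g e)"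
proof (rule definable_fun_graph2[where F = "(-)" and f = f and g = g])
  have "definable_pred (\<lambda>e. e 1 = e 0 + e 2)"
    by (intro definable_eq definable_fun_add definable_fun_var)
  then show "definable_pred (\<lambda>e. e 0 = e 1 - e 2)" by (simp add: eq_diff_eq eq_commute)
qed

lemma definable_near: "definable_fun f \<Longrightarrow> definable_fun g \<Longrightarrow> definable_fun h \<Longrightarrow> definable_pred (\<lambda>e. near (f e) (g e) (h e))"
  unfolding near_def by (intro definable_conj definable_less definable_fun_add)

lemma definable_mem: "definable_pred (\<lambda>e. e 0 \<in> B) \<Longrightarrow> definable_fun f \<Longrightarrow> definable_pred (\<lambda>e. f e \<in> B)"
  by (rule definable_app1)

lemma definable_const: "definable_pred (\<lambda>e. B)"
proof -
  have "definable_pred (\<lambda>e. (0::'a) = 0)" "definable_pred (\<lambda>e. (0::'a) < 0)"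
    by (intro definable_eq definable_less definable_fun_const)+
  then show ?thesis by (cases B) simp_all
qed

lemmas definable_intros = definable_fun_var definable_fun_add definable_fun_diff definable_fun_const definable_neg definable_conj definable_disj definable_imp
  definable_iff definable_bex definable_ball definable_ex definable_all definable_eq definable_less definable_le definable_near

lemma definable_finite_bex:
  assumes "finite B" "\<And>b. b \<in> B \<Longrightarrow> definable_pred (\<lambda>e. P e b)"
  shows "definable_pred (\<lambda>e. \<exists>b\<in>B. P e b)"
  using assms
proof (induction B)
  case empty
  show ?case by (simp add: definable_const)
next
  case (insert b B)
  have "definable_pred (\<lambda>e. P e b \<or> (\<exists>b\<in>B. P e b))"
    by (rule definable_disj) (use insert in auto)
  then show ?case by simp
qed

text \<open>Back to syntax: only the first \<open>n\<close> variables survive, the others being identified with the first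
  one, and the finitely many parameters that occur are collected in a list.\<close>

lemma definable_pred_formula:
  assumes "definable_pred P" "n > 0"
  obtains \<phi> cs where "\<phi> \<in> formulas L (n + length cs)"
    "\<And>xs. length xs = n \<Longrightarrow> holds R \<phi> (xs @ cs) \<longleftrightarrow> P (\<lambda>i. if i < n then xs ! i else xs ! 0)"
proof -
  from assms obtain \<phi> c where \<phi>: "wf_fm L \<phi>" "\<And>e. P e \<longleftrightarrow> sat R (mix e c) \<phi>"
    unfolding definable_pred_def by metis
  obtain K where K: "\<And>k. k \<in> fv \<phi> \<Longrightarrow> k < K"
    using finite_fv[of \<phi>] by (metis finite_nat_set_iff_bounded)
  define \<sigma> where "\<sigma> k = (if even k then if k div 2 < n then k div 2 else 0 else n + k div 2)" for k
  define cs where "cs = map c [0..<K]"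
  obtain \<phi>' where \<phi>': "wf_fm L \<phi>'" "fv \<phi>' \<subseteq> \<sigma> ` fv \<phi>" "\<And>e. sat R e \<phi>' \<longleftrightarrow> sat R (\<lambda>i. e (\<sigma> i)) \<phi>"
    using ex_renamed_formula[OF \<phi>(1), of \<sigma> R] by auto
  have lt: "k div 2 < K" if "k \<in> fv \<phi>" for k using K[OF that] by linarith
  have "\<sigma> ` fv \<phi> \<subseteq> {..<n + length cs}"
    using lt assms(2) by (auto simp: \<sigma>_def cs_def)
  then have "\<phi>' \<in> formulas L (n + length cs)"
    using \<phi>' by (auto simp: formulas_def)
  moreover have "holds R \<phi>' (xs @ cs) \<longleftrightarrow> P (\<lambda>i. if i < n then xs ! i else xs ! 0)"
    if "length xs = n" for xs
  proof -
    have "sat R (\<lambda>i. (xs @ cs) ! \<sigma> i) \<phi> \<longleftrightarrow>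
        sat R (mix (\<lambda>i. if i < n then xs ! i else xs ! 0) c) \<phi>"
      by (rule sat_cong) (use lt that assms(2) in \<open>auto simp: \<sigma>_def mix_def cs_def nth_append\<close>)
    then show ?thesis by (simp add: holds_def \<phi>'(3) \<phi>(2))
  qed
  ultimately show ?thesis by (rule that)
qed

lemma definable_set_imp_pred:
  assumes "definable_set L R A" shows "definable_pred (\<lambda>e. e 0 \<in> A)"
proof -
  from assms obtain \<phi> cs where "defines_rel L R 1 \<phi> cs ((\<lambda>x. [x]) ` A)"
    unfolding definable_set_def definable_def by blast
  then have \<phi>: "wf_fm L \<phi>" and eq: "(\<lambda>x. [x]) ` A = {xs \<in> tuples UNIV 1. holds R \<phi> (xs @ cs)}"
    by (auto simp: defines_rel_def param_formulas_def formulas_def)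
  have "x \<in> A \<longleftrightarrow> [x] \<in> (\<lambda>x. [x]) ` A" for x by auto
  then have A: "x \<in> A \<longleftrightarrow> holds R \<phi> (x # cs)" for x
    unfolding eq by (auto simp: tuples_def)
  show ?thesis
    by (rule definable_predI_rename[where c = "\<lambda>k. cs ! k" and g = "\<lambda>e i. (e 0 # cs) ! i"
          and \<sigma> = "\<lambda>n. if n = 0 then 0 else 2 * n - 1", OF \<phi>])
      (auto simp: mix_def A holds_def nth_Cons split: nat.split)
qed

end

section \<open>Saturation and patterns of depth three\<close>

lemma consistentD:
  "consistent M n p \<Longrightarrow> finite q \<Longrightarrow> q \<subseteq> p \<Longrightarrow> \<exists>xs. realizes M n xs q"
  by (simp add: consistent_def)

lemma realizes_imp_consistent:
  assumes "realizes M n xs p" shows "consistent M n p"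
  unfolding consistent_def
proof (intro allI impI)
  fix q assume "q \<subseteq> p"
  then have "realizes M n xs q" using assms unfolding realizes_def by blast
  then show "\<exists>xs. realizes M n xs q" by blast
qed

lemma infinite_Th:
  fixes L :: "('f, 'r) lang" and M :: "('f, 'r, 'a) struct"
  assumes "is_struct L M" shows "infinite (Th L M)"
proof -
  define S :: "nat \<Rightarrow> ('f, 'r) fm" where "S i = Ex i (Eq (Var i) (Var i))" for i
  have "S i \<in> Th L M" for i
    using assms by (auto simp: S_def Th_def formulas_def holds_def is_struct_def)
  moreover have "inj S" by (auto simp: inj_def S_def)
  ultimately show ?thesis by (meson finite_subset infinite_UNIV_nat finite_imageD image_subset_iff)
qed

context ordered_group_structure
begin

text \<open>The theory has infinitely many sentences, so a countable set of parameters is always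
  small enough for the given degree of saturation.\<close>

lemma countable_saturation:
  fixes P :: "nat \<Rightarrow> 'a \<Rightarrow> bool"
  assumes sat: "saturated L R (cardSuc (card_of (Th L R)))"
    and P: "\<And>k. definable_pred (\<lambda>e. P k (e 0))" and fin: "\<And>K. \<exists>x. \<forall>k<K. P k x"
  shows "\<exists>x. \<forall>k. P k x"
proof -
  have "\<exists>\<phi> cs. \<phi> \<in> formulas L (1 + length cs) \<and> (\<forall>x. holds R \<phi> ([x] @ cs) \<longleftrightarrow> P k x)" for k
  proof -
    obtain \<phi> cs where 1: "\<phi> \<in> formulas L (1 + length cs)"
      "\<And>xs. length xs = 1 \<Longrightarrow> holds R \<phi> (xs @ cs) \<longleftrightarrow> P k (if 0 < (1::nat) then xs ! 0 else xs ! 0)"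
      using definable_pred_formula[OF P[of k], where n = 1] by auto
    then have "holds R \<phi> ([x] @ cs) \<longleftrightarrow> P k x" for x by (subst 1(2)) auto
    with 1(1) show ?thesis by blast
  qed
  then obtain \<phi> cs where \<phi>: "\<And>k. \<phi> k \<in> formulas L (1 + length (cs k))"
    and eq: "\<And>k x. holds R (\<phi> k) ([x] @ cs k) \<longleftrightarrow> P k x" by metis
  define A where "A = (\<Union>k. set (cs k))"
  define p where "p = range (\<lambda>k. (\<phi> k, cs k))"
  have "countable A" unfolding A_def by (auto intro: countable_UN countable_finite)
  have "infinite (Th L R)"
    using expands by (intro infinite_Th) (simp add: expands_ordered_group_def)
  then obtain g :: "nat \<Rightarrow> ('f, 'r) fm" where g: "inj g" "range g \<subseteq> Th L R"
    using infinite_countable_subset by blast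
  obtain f :: "'a \<Rightarrow> nat" where "inj_on f A" using \<open>countable A\<close> by (auto simp: countable_def)
  then have "inj_on (g \<circ> f) A" using g(1) by (meson comp_inj_on inj_on_subset subset_UNIV)
  then have "(card_of A, card_of (Th L R)) \<in> ordLeq"
    using g(2) by (intro card_of_ordLeqI[of "g \<circ> f"]) auto
  then have "(card_of A, cardSuc (card_of (Th L R))) \<in> ordLess"
    using cardSuc_greater[OF card_of_Card_order] ordLeq_ordLess_trans by blast
  moreover have "p \<subseteq> param_formulas L A 1"
    using \<phi> by (auto simp: p_def param_formulas_def A_def)
  moreover have "consistent R 1 p" unfolding consistent_def
  proof (intro allI impI)
    fix q assume "finite q" "q \<subseteq> p"
    then obtain S where S: "finite S" "q = (\<lambda>k. (\<phi> k, cs k)) ` S"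
      unfolding p_def by (meson finite_subset_image)
    obtain K where "\<forall>k\<in>S. k < K" using S(1) finite_nat_set_iff_bounded by blast
    moreover obtain x where "\<forall>k<K. P k x" using fin by blast
    ultimately have "realizes R 1 [x] q"
      unfolding realizes_def S(2) using eq by (auto simp: tuples_def)
    then show "\<exists>xs. realizes R 1 xs q" by blast
  qed
  ultimately obtain xs where "realizes R 1 xs p"
    using sat unfolding saturated_def by (metis subset_UNIV univ_R)
  then obtain x where "\<forall>k. holds R (\<phi> k) ([x] @ cs k)"
    unfolding realizes_def p_def tuples_def by (auto simp: length_Suc_conv)
  then show ?thesis using eq by blast
qed

text \<open>The structure itself serves as the model of its theory in which the forbidden pattern lives.\<close>

lemma depth_three_pattern:
  fixes Q :: "nat \<Rightarrow> 'a \<Rightarrow> 'a \<Rightarrow> 'a \<Rightarrow> bool" and a b :: "nat \<Rightarrow> nat \<Rightarrow> 'a"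
  assumes burden: "burden_less L R 1 {Eq (Var 0) (Var 0)} 3"
    and Q: "\<And>i. i < 3 \<Longrightarrow> definable_pred (\<lambda>e. Q i (e 0) (e 1) (e 2))"
    and k: "\<And>i. i < 3 \<Longrightarrow> k i > 0"
    and incons: "\<And>i J x. i < 3 \<Longrightarrow> card J = k i \<Longrightarrow> \<exists>j\<in>J. \<not> Q i x (a i j) (b i j)"
    and cons: "\<And>\<eta>. \<exists>x. \<forall>i<3. Q i x (a i (\<eta> i)) (b i (\<eta> i))"
  shows False
proof -
  have "\<exists>\<phi> cs. \<phi> \<in> formulas L (3 + length cs) \<and>
      (\<forall>x a b. holds R \<phi> ([x] @ [a, b] @ cs) \<longleftrightarrow> Q i x a b)" if i: "i < 3" for i
  proof -
    obtain \<phi> cs where 1: "\<phi> \<in> formulas L (3 + length cs)"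
      "\<And>xs. length xs = 3 \<Longrightarrow> holds R \<phi> (xs @ cs) \<longleftrightarrow> Q i (xs ! 0) (xs ! 1) (xs ! 2)"
      using definable_pred_formula[OF Q[OF i], where n = 3] by auto
    have "holds R \<phi> ([x] @ [a, b] @ cs) \<longleftrightarrow> Q i x a b" for x a b
      using 1(2)[of "[x, a, b]"] by simp
    with 1(1) show ?thesis by blast
  qed
  then obtain \<phi> cs where \<phi>: "\<And>i. i < 3 \<Longrightarrow> \<phi> i \<in> formulas L (3 + length (cs i))"
    and eq: "\<And>i x a b. i < 3 \<Longrightarrow> holds R (\<phi> i) ([x] @ [a, b] @ cs i) \<longleftrightarrow> Q i x a b"
    by metis
  define par where "par i j = [a i j, b i j] @ cs i" for i j
  have real: "realizes R 1 [x] q \<longleftrightarrow> (\<forall>(\<psi>, as)\<in>q. holds R \<psi> ([x] @ as))" for x q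
    by (simp add: realizes_def tuples_def)
  have single: "\<exists>x. xs = [x]" if "realizes R 1 xs q" for xs q
    using that by (auto simp: realizes_def tuples_def length_Suc_conv)
  have "inp_pattern L R 1 ((\<lambda>\<psi>. (\<psi>, [])) ` {Eq (Var 0) (Var 0)}) {..<3} \<phi>
      (\<lambda>i. 2 + length (cs i)) k par"
    unfolding inp_pattern_def
  proof (intro conjI ballI allI impI)
    fix i :: nat assume "i \<in> {..<3}" then have i: "i < 3" by simp
    show "\<phi> i \<in> formulas L (1 + (2 + length (cs i)))" using \<phi>[OF i] by (simp add: numeral_3_eq_3)
    show "0 < k i" using k[OF i] .
    show "par i j \<in> tuples (univ R) (2 + length (cs i))" for j by (simp add: par_def tuples_def)
    fix J :: "nat set" assume J: "card J = k i"
    then have "finite J" using k[OF i] card_gt_0_iff by metis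
    show "\<not> consistent R 1 {(\<phi> i, par i j) |j. j \<in> J}"
    proof
      assume "consistent R 1 {(\<phi> i, par i j) |j. j \<in> J}"
      moreover have "finite {(\<phi> i, par i j) |j. j \<in> J}" using \<open>finite J\<close> by simp
      ultimately have "\<exists>xs. realizes R 1 xs {(\<phi> i, par i j) |j. j \<in> J}"
        by (rule consistentD) simp
      then obtain xs where xs: "realizes R 1 xs {(\<phi> i, par i j) |j. j \<in> J}" by blast
      obtain x where "xs = [x]" using single[OF xs] by blast
      with xs have x: "\<forall>(\<psi>, as)\<in>{(\<phi> i, par i j) |j. j \<in> J}. holds R \<psi> ([x] @ as)"
        by (simp only: real)
      have "Q i x (a i j) (b i j)" if "j \<in> J" for j
      proof -
        have "holds R (\<phi> i) ([x] @ par i j)"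
          using bspec[OF x, of "(\<phi> i, par i j)"] that by auto
        then show ?thesis using eq[OF i] by (simp add: par_def)
      qed
      then show False using incons[OF i J] by blast
    qed
  next
    fix \<eta> :: "nat \<Rightarrow> nat"
    obtain x where x: "\<forall>i<3. Q i x (a i (\<eta> i)) (b i (\<eta> i))" using cons by blast
    have "realizes R 1 [x] ((\<lambda>\<psi>. (\<psi>, [])) ` {Eq (Var 0) (Var 0)} \<union>
        {(\<phi> i, par i (\<eta> i)) |i. i \<in> {..<3}})"
      unfolding real using x eq by (auto simp: par_def holds_def)
    then show "consistent R 1 ((\<lambda>\<psi>. (\<psi>, [])) ` {Eq (Var 0) (Var 0)} \<union>
        {(\<phi> i, par i (\<eta> i)) |i. i \<in> {..<3}})"
      by (rule realizes_imp_consistent)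
  qed
  moreover have "is_model L (Th L R) R"
    using expands by (auto simp: is_model_def expands_ordered_group_def Th_def)
  ultimately show False using burden unfolding burden_less_def by blast
qed

end

section \<open>Consequences of saturation for the order\<close>

locale saturated_structure = ordered_group_structure L R lt pl
  for L :: "('f, 'r) lang"
    and R :: "('f, 'r, 'a::{linordered_ab_group_add, linorder_topology, dense_linorder}) struct"
    and lt :: 'r and pl :: 'f +
  assumes sat: "saturated L R (cardSuc (card_of (Th L R)))"
begin

text \<open>The positive elements have uncountable coinitiality. This is the only form in which saturation
  enters many of the arguments: countably many radii may be replaced by a single one.\<close>

lemma ex_pos_below:
  fixes r :: "nat \<Rightarrow> 'a"
  assumes "\<And>n. 0 < r n" shows "\<exists>s>0. \<forall>n. s < r n"
proof -
  have fin: "\<exists>x>0. \<forall>k<K. x < r k" for K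
  proof (induction K)
    case 0
    show ?case using assms by blast
  next
    case (Suc K)
    then obtain x where x: "0 < x" "\<forall>k<K. x < r k" by blast
    obtain y where "0 < y" "y < min x (r K)" using dense[of 0 "min x (r K)"] x(1) assms by auto
    then show ?case using x(2) by (intro exI[of _ y]) (auto simp: less_Suc_eq)
  qed
  define P where "P k x \<longleftrightarrow> 0 < x \<and> x < r k" for k x
  have "\<exists>x. \<forall>k. P k x"
  proof (rule countable_saturation[OF sat])
    show "definable_pred (\<lambda>e. P k (e 0))" for k unfolding P_def by (intro definable_intros)
    show "\<exists>x. \<forall>k<K. P k x" for K using fin[of K] unfolding P_def by blast
  qed
  then show ?thesis unfolding P_def by blast
qed

text \<open>Balls are uncountable, by saturation applied to the formulas \<open>x \<noteq> g k\<close>.\<close>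

lemma ex_near_not_in_countable:
  assumes "countable C" "0 < r" shows "\<exists>y::'a. near r y c \<and> y \<notin> C"
proof (cases "C = {}")
  case True
  then show ?thesis using assms(2) by (intro exI[of _ c]) simp
next
  case False
  define g where "g = from_nat_into C"
  have g: "range g = C" unfolding g_def using False assms(1) by (rule range_from_nat_into)
  define P where "P k x \<longleftrightarrow> near r x c \<and> x \<noteq> g k" for k x
  have "\<exists>x. \<forall>k. P k x"
  proof (rule countable_saturation[OF sat])
    show "definable_pred (\<lambda>e. P k (e 0))" for k unfolding P_def by (intro definable_intros)
    fix K
    have "infinite ({x. near r x c} - g ` {..<K})"
      using infinite_ball[OF assms(2)] by (simp add: Diff_infinite_finite)
    then obtain x where "x \<in> {x. near r x c} - g ` {..<K}" using infinite_imp_nonempty by blast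
    then show "\<exists>x. \<forall>k<K. P k x" unfolding P_def by blast
  qed
  then show ?thesis using g unfolding P_def by blast
qed

lemma ex_ball_in_nested_balls:
  assumes r: "\<And>n::nat. 0 < r n" and nested: "\<And>m n z. m < n \<Longrightarrow> near (r n) z (c n) \<Longrightarrow> near (r m) z (c m)"
  shows "\<exists>s>0. \<exists>x::'a. \<forall>n z. near s z x \<longrightarrow> near (r n) z (c n)"
proof -
  have "\<exists>x. \<forall>n. near (r n) x (c n)"
  proof (rule countable_saturation[OF sat])
    show "definable_pred (\<lambda>e. near (r k) (e 0) (c k))" for k by (intro definable_intros)
    show "\<exists>x. \<forall>k<K. near (r k) x (c k)" for K
      by (rule exI[of _ "c K"]) (use r nested in auto)
  qed
  then obtain x where "\<And>n. near (r n) x (c n)" by blast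
  then have "\<forall>n. \<exists>s>0. \<forall>z. near s z x \<longrightarrow> near (r n) z (c n)"
    using near_interior by blast
  then obtain s where s: "\<And>n. 0 < s n" "\<And>n z. near (s n) z x \<Longrightarrow> near (r n) z (c n)" by metis
  obtain s' where "0 < s'" "\<And>n. s' < s n" using ex_pos_below[of s] s(1) by blast
  with s(2) show ?thesis by (meson less_imp_le near_mono)
qed

lemma ex_separated_sequence:
  fixes S :: "'a set"
  assumes "infinite S"
  obtains p :: "nat \<Rightarrow> 'a" and r where "\<And>i. p i \<in> S" "inj p" "0 < r"
    "\<And>z i j. near r z (p i) \<Longrightarrow> near r z (p j) \<Longrightarrow> i = j"
proof -
  obtain p :: "nat \<Rightarrow> 'a" where p: "inj p" "range p \<subseteq> S"
    using infinite_countable_subset[OF assms] by blast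
  have dist: "\<exists>s>0. \<not> near s x y" if "x \<noteq> y" for x y :: 'a
    using that by (intro exI[of _ "if x < y then y - x else x - y"]) (auto simp: near_def)
  have "p 0 \<noteq> p 1" using p(1) by (auto simp: inj_def)
  then have "\<forall>i j. \<exists>s>0. i \<noteq> j \<longrightarrow> \<not> near s (p i) (p j)"
    using dist p(1) by (metis injD)
  then obtain \<delta> where \<delta>: "\<And>i j. 0 < \<delta> i j" "\<And>i j. i \<noteq> j \<Longrightarrow> \<not> near (\<delta> i j) (p i) (p j)"
    by metis
  obtain s where s: "0 < s" "\<And>n. s < \<delta> (fst (prod_decode n)) (snd (prod_decode n))"
    using ex_pos_below[of "\<lambda>n. \<delta> (fst (prod_decode n)) (snd (prod_decode n))"] \<delta>(1) by blast
  have s': "s < \<delta> i j" for i j using s(2)[of "prod_encode (i, j)"] by simp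
  obtain r where r: "0 < r" "r + r \<le> s" using ex_half[OF s(1)] by blast
  have "i = j" if "near r z (p i)" "near r z (p j)" for z i j
  proof (rule ccontr)
    assume "i \<noteq> j"
    have "near (r + r) (p i) (p j)" using near_trans[of r "p i" z r "p j"] that near_sym by blast
    then have "near (\<delta> i j) (p i) (p j)" using near_mono r(2) s' by (meson less_imp_le order_trans)
    then show False using \<delta>(2)[OF \<open>i \<noteq> j\<close>] by simp
  qed
  with p r(1) show ?thesis by (intro that[of p r]) auto
qed

end

section \<open>Small balls carry only one row\<close>

text \<open>The set \<open>D\<close> is already separated: a ball of radius \<open>\<eta>\<close> meets it in at most one point. Balls of
  this radius are the windows in which the burden drops to one.\<close>

locale small_window = saturated_structure L R lt pl
  for L :: "('f, 'r) lang"
    and R :: "('f, 'r, 'a::{linordered_ab_group_add, linorder_topology, dense_linorder}) struct"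
    and lt :: 'r and pl :: 'f +
  fixes D :: "'a set" and \<eta> :: 'a
  assumes burden: "burden_less L R 1 {Eq (Var 0) (Var 0)} 3"
    and definable_D: "definable_pred (\<lambda>e. e 0 \<in> D)" and infinite_D: "infinite D"
    and pos: "0 < \<eta>"
    and separated: "\<And>z d d'. d \<in> D \<Longrightarrow> d' \<in> D \<Longrightarrow> near \<eta> z d \<Longrightarrow> near \<eta> z d' \<Longrightarrow> d = d'"
begin

text \<open>A point \<open>x\<close> close to \<open>D\<close> determines the element \<open>d\<close> of \<open>D\<close> next to it, so it encodes the pair
  of \<open>d\<close> and of \<open>z = x - d + w\<close> in the window around \<open>w\<close>. Conditions on \<open>z\<close> lift to
  conditions on \<open>x\<close> without losing inconsistency since \<open>d\<close> is unique, and the choice of \<open>d\<close> among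
  infinitely many points is one more, independent, row.\<close>

lemma no_two_rows_in_window:
  fixes Q Q' :: "'a \<Rightarrow> 'a \<Rightarrow> 'a \<Rightarrow> bool" and k k' :: nat
    and a b a' b' :: "nat \<Rightarrow> 'a"
  assumes Q: "definable_pred (\<lambda>e. Q (e 0) (e 1) (e 2))" and Q': "definable_pred (\<lambda>e. Q' (e 0) (e 1) (e 2))"
    and k: "0 < k" and k': "0 < k'"
    and inc: "\<And>J z. near \<eta> z w \<Longrightarrow> card J = k \<Longrightarrow> \<exists>j\<in>J. \<not> Q z (a j) (b j)"
    and inc': "\<And>J z. near \<eta> z w \<Longrightarrow> card J = k' \<Longrightarrow> \<exists>j\<in>J. \<not> Q' z (a' j) (b' j)"
    and cons: "\<And>i j. \<exists>z. near \<eta> z w \<and> Q z (a i) (b i) \<and> Q' z (a' j) (b' j)"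
  shows False
proof -
  obtain d :: "nat \<Rightarrow> 'a" where d: "inj d" "range d \<subseteq> D"
    using infinite_countable_subset[OF infinite_D] by blast
  define lift where "lift P x a b \<longleftrightarrow> (\<exists>d\<in>D. near \<eta> x d \<and> P (x - d + w) a b)"
    for P :: "'a \<Rightarrow> 'a \<Rightarrow> 'a \<Rightarrow> bool" and x a b
  have definable_lift: "definable_pred (\<lambda>e. lift P (e 0) (e 1) (e 2))" if "definable_pred (\<lambda>e. P (e 0) (e 1) (e 2))" for P
  proof -
    have "definable_pred (\<lambda>e. P (e (Suc 0) - e 0 + w) (e (Suc 1)) (e (Suc 2)))"
      by (rule definable_app3[OF that]) (intro definable_intros)+
    then show ?thesis unfolding lift_def by (intro definable_intros definable_D)
  qed
  have shift: "near \<eta> (x - d + w) w \<longleftrightarrow> near \<eta> x d" for x d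
    using near_add_right[of \<eta> "x - d" w 0] near_diff_0[of \<eta> x d] by simp
  have inc_lift: "\<exists>j\<in>J. \<not> lift G x (f j) (g j)"
    if G: "\<And>J z. near \<eta> z w \<Longrightarrow> card J = l \<Longrightarrow> \<exists>j\<in>J. \<not> G z (f j) (g j)"
      and J: "card J = l" and "0 < l"
    for G x f g and l :: nat and J :: "nat set"
  proof (cases "\<exists>d\<in>D. near \<eta> x d")
    case True
    then obtain d where d: "d \<in> D" "near \<eta> x d" by blast
    then obtain j where "j \<in> J" "\<not> G (x - d + w) (f j) (g j)" using G[OF _ J] shift by blast
    moreover have "d' = d" if "d' \<in> D" "near \<eta> x d'" for d' using separated[OF that(1) d(1) that(2) d(2)] .
    ultimately show ?thesis unfolding lift_def by blast
  next
    case False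
    have "J \<noteq> {}" using J \<open>0 < l\<close> by auto
    then show ?thesis using False unfolding lift_def by blast
  qed
  have two: "\<exists>j\<in>J. \<not> near \<eta> x (d j)" if J: "card J = 2" for J x
  proof -
    obtain i j where ij: "J = {i, j}" "i \<noteq> j" using J by (auto simp: card_2_iff)
    then have "d i \<noteq> d j" using d(1) by (auto simp: inj_def)
    then show ?thesis using separated[of "d i" "d j" x] d(2) ij by blast
  qed
  have three: "i = 0 \<or> i = 1 \<or> i = 2" if "i < 3" for i :: nat using that by auto
  show False
  proof (rule depth_three_pattern[where
        Q = "\<lambda>i. if i = 0 then (\<lambda>x a b. near \<eta> x a) else if i = 1 then lift Q else lift Q'" and
        k = "\<lambda>i. if i = 0 then 2 else if i = 1 then k else k'" and
        a = "\<lambda>i. if i = 0 then d else if i = 1 then a else a'" and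
        b = "\<lambda>i. if i = 0 then d else if i = 1 then b else b'", OF burden])
    fix i :: nat assume "i < 3"
    then consider "i = 0" | "i = 1" | "i = 2" using three by blast
    then show "definable_pred (\<lambda>e. (if i = 0 then (\<lambda>x a b. near \<eta> x a) else if i = 1 then lift Q else lift Q')
        (e 0) (e 1) (e 2))"
    proof cases
      case 1
      have "definable_pred (\<lambda>e. near \<eta> (e 0) (e 1))" by (intro definable_intros)
      then show ?thesis using 1 by simp
    qed (use definable_lift[OF Q] definable_lift[OF Q'] in simp_all)
  next
    fix i :: nat assume "i < 3"
    show "0 < (if i = 0 then 2 else if i = 1 then k else k')" using k k' by simp
  next
    fix i :: nat and J :: "nat set" and x :: 'a
    assume "i < 3" and J: "card J = (if i = 0 then 2 else if i = 1 then k else k')"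
    then consider "i = 0" | "i = 1" | "i = 2" using three by blast
    then show "\<exists>j\<in>J. \<not> (if i = 0 then (\<lambda>x a b. near \<eta> x a) else if i = 1 then lift Q else lift Q') x
       ((if i = 0 then d else if i = 1 then a else a') j)
       ((if i = 0 then d else if i = 1 then b else b') j)"
    proof cases
      case 1 then show ?thesis using two J by simp
    next
      case 2 then show ?thesis using inc_lift[where G = Q and f = a and g = b and l = k, OF inc _ k] J by simp
    next
      case 3 then show ?thesis using inc_lift[where G = Q' and f = a' and g = b' and l = k', OF inc' _ k'] J by simp
    qed
  next
    fix \<theta> :: "nat \<Rightarrow> nat"
    obtain z where z: "near \<eta> z w" "Q z (a (\<theta> 1)) (b (\<theta> 1))" "Q' z (a' (\<theta> 2)) (b' (\<theta> 2))"
      using cons by blast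
    define x where "x = z - w + d (\<theta> 0)"
    have x: "x - d (\<theta> 0) + w = z" "near \<eta> x (d (\<theta> 0))" "d (\<theta> 0) \<in> D"
      using z(1) d(2) shift[of x "d (\<theta> 0)"] by (auto simp: x_def)
    have "lift Q x (a (\<theta> 1)) (b (\<theta> 1))" "lift Q' x (a' (\<theta> 2)) (b' (\<theta> 2))"
      unfolding lift_def using x z(2,3) by metis+
    then have "\<forall>i<3. (if i = 0 then (\<lambda>x a b. near \<eta> x a) else if i = 1 then lift Q else lift Q') x
       ((if i = 0 then d else if i = 1 then a else a') (\<theta> i))
       ((if i = 0 then d else if i = 1 then b else b') (\<theta> i))"
      using x(2) by (auto dest!: three)
    then show "\<exists>x. \<forall>i<3. (if i = 0 then (\<lambda>x a b. near \<eta> x a) else if i = 1 then lift Q else lift Q') x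
       ((if i = 0 then d else if i = 1 then a else a') (\<theta> i))
       ((if i = 0 then d else if i = 1 then b else b') (\<theta> i))" by blast
  qed
qed

text \<open>The second row is made of infinitely many pairwise disjoint balls inside the common ball. Each of them
  meets each of the dense sets.\<close>

lemma no_dense_row:
  fixes Q :: "'a \<Rightarrow> 'a \<Rightarrow> 'a \<Rightarrow> bool" and k :: nat and a b :: "nat \<Rightarrow> 'a"
  assumes Q: "definable_pred (\<lambda>e. Q (e 0) (e 1) (e 2))" and k: "0 < k"
    and inc: "\<And>J z. near \<eta> z w \<Longrightarrow> card J = k \<Longrightarrow> \<exists>j\<in>J. \<not> Q z (a j) (b j)"
    and r: "0 < r" and ball: "\<And>z. near r z c \<Longrightarrow> near \<eta> z w"
    and dense: "\<And>j. dense_in {z. Q z (a j) (b j)} c r"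
  shows False
proof -
  obtain p :: "nat \<Rightarrow> 'a" and s where p: "\<And>i. p i \<in> {x. near r x c}" and s: "0 < s"
    and sep: "\<And>z i j. near s z (p i) \<Longrightarrow> near s z (p j) \<Longrightarrow> i = j"
    using ex_separated_sequence[OF infinite_ball[OF r, of c]] by metis
  have two: "\<exists>j\<in>J. \<not> near s z (p j)" if "card J = 2" for J z
    using that sep unfolding card_2_iff by (metis insertCI)
  have "definable_pred (\<lambda>e. near s (e 0) (e 1))" by (intro definable_intros)
  then show False
  proof (rule no_two_rows_in_window[where Q = "\<lambda>x a b. near s x a" and w = w and a = p and b = p
        and k = 2, OF _ Q _ k _ inc])
    fix i j
    have "near r (p i) c" using p by simp
    from near_interior[OF this] obtain t where t: "0 < t" "\<And>z. near t z (p i) \<Longrightarrow> near r z c" by blast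
    from dense[unfolded dense_in_def] \<open>near r (p i) c\<close> s t(1) obtain z where
      z: "Q z (a j) (b j)" "near (min s t) z (p i)" by (metis (no_types, lifting) mem_Collect_eq min_less_iff_conj)
    then have "near s z (p i)" "near t z (p i)" using near_mono by (meson min.cobounded1 min.cobounded2)+
    then show "\<exists>z. near \<eta> z w \<and> near s z (p i) \<and> Q z (a j) (b j)"
      using z(1) t(2) ball by blast
  qed (use two in auto)
qed

text \<open>Suppose that \<open>N\<close> is infinite. One row chooses a member of a separated sequence \<open>p\<close> in \<open>N\<close> close to
  \<open>z\<close>. The other one says that the distance from \<open>z\<close> to \<open>N\<close> lies between consecutive terms of a
  decreasing sequence \<open>c\<close>. Near every \<open>p j\<close> and at every scale \<open>c k\<close> there are gaps of \<open>N\<close>; since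
  countably many gaps have a common lower bound on their size, \<open>c (Suc k)\<close> can be chosen so that the
  bounds are attained near all \<open>p j\<close> simultaneously.\<close>

lemma nowhere_dense_finite:
  assumes definable_N: "definable_pred (\<lambda>e. e 0 \<in> N)" and nd: "nowhere_dense N"
    and window: "\<And>z. z \<in> N \<Longrightarrow> near \<eta> z w"
  shows "finite N"
proof (rule ccontr)
  assume "infinite N"
  then obtain p :: "nat \<Rightarrow> 'a" and r where p: "\<And>i. p i \<in> N" and r: "0 < r"
    and sep: "\<And>z i j. near r z (p i) \<Longrightarrow> near r z (p j) \<Longrightarrow> i = j"
    using ex_separated_sequence by metis
  have "\<forall>i. \<exists>t>0. \<forall>z. near t z (p i) \<longrightarrow> near \<eta> z w"
    using near_interior window p by blast
  then obtain t where t: "\<And>i. 0 < t i" "\<And>i z. near (t i) z (p i) \<Longrightarrow> near \<eta> z w" by metis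
  obtain t0 where t0: "0 < t0" "\<And>i. t0 < t i" using ex_pos_below[of t] t(1) by blast
  have step: "\<exists>c'>0. c' < c \<and> (\<forall>j. \<exists>z. near c z (p j) \<and> (\<forall>y\<in>N. \<not> near c' z y))" if "0 < c" for c
  proof -
    have "\<forall>j. \<exists>x s. 0 < s \<and> (\<forall>z. near s z x \<longrightarrow> near c z (p j) \<and> z \<notin> N)"
      using nd that unfolding nowhere_dense_def by blast
    then obtain x s where xs: "\<And>j. 0 < s j" "\<And>j z. near (s j) z (x j) \<Longrightarrow> near c z (p j) \<and> z \<notin> N" by metis
    have "0 < min c (s j)" for j using xs(1) that by simp
    then obtain c' where c': "0 < c'" "\<And>j. c' < min c (s j)"
      using ex_pos_below[of "\<lambda>j. min c (s j)"] by blast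
    have "near c (x j) (p j) \<and> (\<forall>y\<in>N. \<not> near c' (x j) y)" for j
    proof -
      have "\<not> near c' (x j) y" if "y \<in> N" for y
      proof
        assume "near c' (x j) y"
        then have "near (s j) y (x j)" using c'(2)[of j] near_mono near_sym by (metis less_imp_le min_less_iff_conj)
        then show False using xs(2) that by blast
      qed
      then show ?thesis using xs(2)[of j "x j"] xs(1) by simp
    qed
    moreover have "c' < c" using c'(2)[of 0] by simp
    ultimately show ?thesis using c'(1) by blast
  qed
  obtain c :: "nat \<Rightarrow> 'a" where c: "\<And>k. 0 < c k \<and> c k \<le> min r t0"
    "\<And>k. c (Suc k) < c k \<and> (\<forall>j. \<exists>z. near (c k) z (p j) \<and> (\<forall>y\<in>N. \<not> near (c (Suc k)) z y))"
  proof -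
    have "\<exists>c. \<forall>k. (0 < c k \<and> c k \<le> min r t0) \<and>
        (c (Suc k) < c k \<and> (\<forall>j. \<exists>z. near (c k) z (p j) \<and> (\<forall>y\<in>N. \<not> near (c (Suc k)) z y)))"
    proof (rule dependent_nat_choice)
      show "\<exists>x. 0 < x \<and> x \<le> min r t0" using r t0(1) by (intro exI[of _ "min r t0"]) simp
      fix x :: 'a and n :: nat assume "0 < x \<and> x \<le> min r t0"
      then show "\<exists>y. (0 < y \<and> y \<le> min r t0) \<and>
          y < x \<and> (\<forall>j. \<exists>z. near x z (p j) \<and> (\<forall>ya\<in>N. \<not> near y z ya))"
        using step[of x] by (meson less_imp_le order_trans)
    qed
    then show ?thesis using that by blast
  qed
  have c_mono: "c j \<le> c i" if "i \<le> j" for i j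
    using c(2) that lift_Suc_antimono_le[of c] by (metis less_imp_le)
  define Q where "Q z a b \<longleftrightarrow> (\<forall>y\<in>N. \<not> near a z y) \<and> (\<exists>y\<in>N. near b z y)" for z a b
  have definable_Q: "definable_pred (\<lambda>e. Q (e 0) (e 1) (e 2))"
    unfolding Q_def by (intro definable_intros definable_N)
  have two: "\<exists>j\<in>J. \<not> near r z (p j)" if "card J = 2" for J z
    using that sep unfolding card_2_iff by (metis insertCI)
  have Q_unique: False if "i < j" "Q z (c (Suc i)) (c i)" "Q z (c (Suc j)) (c j)" for z i j
    using that c_mono[of "Suc i" j] unfolding Q_def by (meson Suc_leI near_mono)
  have two': "\<exists>j\<in>J. \<not> Q z (c (Suc j)) (c j)" if "card J = 2" for J z
    using that Q_unique unfolding card_2_iff by (metis insertCI linorder_neqE_nat)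
  have "definable_pred (\<lambda>e. near r (e 0) (e 1))" by (intro definable_intros)
  then show False
  proof (rule no_two_rows_in_window[where Q = "\<lambda>x a b. near r x a" and w = w and a = p and b = p
        and k = 2 and k' = 2 and a' = "\<lambda>k. c (Suc k)" and b' = c, OF _ definable_Q])
    fix i j
    obtain z where z: "near (c j) z (p i)" "\<forall>y\<in>N. \<not> near (c (Suc j)) z y" using c(2) by blast
    have "c j \<le> r" "c j \<le> t i" using c(1)[of j] t0(2)[of i] by auto
    then have "near r z (p i)" "near \<eta> z w" using z(1) near_mono t(2) by blast+
    then show "\<exists>z. near \<eta> z w \<and> near r z (p i) \<and> Q z (c (Suc j)) (c j)"
      using z p unfolding Q_def by blast
  qed (use two two' in auto)
qed

end

section \<open>Alternation along homogeneous sequences\<close>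

text \<open>Colour an \<open>m\<close>-element set of indices by the collection of patterns that some \<open>x\<close> realizes on it
  and pass to a homogeneous sequence \<open>h\<close>. Suppose that the truth value at \<open>x\<close> changes inside
  \<open>m\<close> of the pairs \<open>h (2 * j), h (2 * j + 1)\<close>. Then for every pattern one can pick one
  index of each pair so that \<open>x\<close> realizes that pattern on the picked indices. Different patterns lead to
  different sets of indices, but by homogeneity all patterns are realized on the same one,
  contrary to the assumption.\<close>

lemma no_frequent_alternation:
  fixes A :: "nat \<Rightarrow> 'x \<Rightarrow> bool" and m :: nat
  assumes not_shattered: "\<And>e :: nat \<Rightarrow> nat. \<exists>T\<subseteq>{..<m}. \<forall>x. \<exists>i<m. A (e i) x \<noteq> (i \<in> T)"
  obtains h :: "nat \<Rightarrow> nat" where "strict_mono h"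
    "\<And>J x. card J = m \<Longrightarrow> \<exists>j\<in>J. A (h (2 * j)) x = A (h (2 * j + 1)) x"
proof -
  have m: "0 < m" using not_shattered[of id] by (cases m) auto
  define C where "C S = {T. T \<subseteq> {..<m} \<and> (\<exists>x. \<forall>i<m. A (sorted_list_of_set S ! i) x = (i \<in> T))}" for S
  define M where "M = Pow (Pow {..<m})"
  have "finite M" by (simp add: M_def)
  from ex_bij_betw_finite_nat[OF this] obtain g where bij: "bij_betw g M {0..<card M}" ..
  then have g: "inj_on g M" "\<And>B. B \<in> M \<Longrightarrow> g B < card M"
    using bij_betw_apply[OF bij] by (auto simp: bij_betw_def)
  have C: "C S \<in> M" for S by (auto simp: C_def M_def)
  have "\<exists>Y t. Y \<subseteq> UNIV \<and> infinite Y \<and> t < card M \<and>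
      (\<forall>S. S \<subseteq> Y \<and> finite S \<and> card S = m \<longrightarrow> g (C S) = t)"
    by (rule Ramsey) (use g(2) C in auto)
  then obtain Y t where Y: "infinite Y"
    and hom: "\<forall>S. S \<subseteq> Y \<and> finite S \<and> card S = m \<longrightarrow> g (C S) = t"
    by (elim exE conjE) (rule that)
  define h where "h = enumerate Y"
  have h: "strict_mono h" "\<And>n. h n \<in> Y"
    unfolding h_def using Y strict_mono_enumerate enumerate_in_set by blast+
  have "\<exists>j\<in>J. A (h (2 * j)) x = A (h (2 * j + 1)) x" if J: "card J = m" for J x
  proof (rule ccontr)
    assume "\<not> ?thesis"
    then have alt: "A (h (2 * j)) x \<noteq> A (h (2 * j + 1)) x" if "j \<in> J" for j using that by blast
    have "finite J" using J m card_gt_0_iff by metis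
    define jj where "jj i = sorted_list_of_set J ! i" for i
    have jj_in: "jj i \<in> J" if "i < m" for i
      using that \<open>finite J\<close> J unfolding jj_def
      by (metis nth_mem sorted_list_of_set.set_sorted_key_list_of_set length_sorted_list_of_set)
    have jj_less: "jj i < jj i'" if "i < i'" "i' < m" for i i'
      using that J unfolding jj_def
      by (metis strict_sorted_list_of_set sorted_wrt_nth_less length_sorted_list_of_set)
    \<comment> \<open>the index inside the \<open>i\<close>-th pair where the truth value at \<open>x\<close> is the one prescribed by \<open>T\<close>\<close>
  define u where "u T i = (if A (h (2 * jj i)) x = (i \<in> T) then 2 * jj i else 2 * jj i + 1)" for T :: "nat set" and i
    have u_less: "h (u T i) < h (u T i')" if "i < i'" "i' < m" for T i i'
    proof -
      have "u T i < u T i'" using jj_less[OF that] by (auto simp: u_def)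
      then show ?thesis using h(1) by (simp add: strict_mono_less)
    qed
    define S where "S T = (\<lambda>i. h (u T i)) ` {..<m}" for T
    have list_S: "sorted_list_of_set (S T) = map (\<lambda>i. h (u T i)) [0..<m]" for T
    proof -
      have "sorted_wrt (<) (map (\<lambda>i. h (u T i)) [0..<m])"
        using u_less by (auto simp: sorted_wrt_iff_nth_less)
      then have "sorted_list_of_set (set (map (\<lambda>i. h (u T i)) [0..<m])) = map (\<lambda>i. h (u T i)) [0..<m]"
        by (simp only: sorted_list_of_set.idem_if_sorted_distinct strict_sorted_iff)
      moreover have "set (map (\<lambda>i. h (u T i)) [0..<m]) = S T" by (auto simp: S_def)
      ultimately show ?thesis by simp
    qed
    have card_S: "card (S T) = m" for T
      using list_S[of T] by (metis length_map length_sorted_list_of_set length_upt minus_nat.diff_0)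
    have "A (h (u T i)) x = (i \<in> T)" if "i < m" for T i
      using alt[OF jj_in[OF that]] by (auto simp: u_def)
    then have in_C: "T \<in> C (S T)" if "T \<subseteq> {..<m}" for T
      using that unfolding C_def list_S by auto
    obtain T where T: "T \<subseteq> {..<m}" "\<And>x. \<exists>i<m. A (sorted_list_of_set (S {}) ! i) x \<noteq> (i \<in> T)"
      using not_shattered[of "\<lambda>i. sorted_list_of_set (S {}) ! i"] by blast
    have "S T' \<subseteq> Y" "finite (S T')" for T' using h(2) by (auto simp: S_def)
    then have "g (C (S T')) = t" for T' using hom card_S by simp
    then have "g (C (S T)) = g (C (S {}))" by simp
    then have "C (S T) = C (S {})" using g(1) C by (meson inj_onD)
    then have "T \<in> C (S {})" using in_C[OF T(1)] by simp
    then show False using T(2) unfolding C_def by blast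
  qed
  with h(1) show ?thesis by (rule that)
qed

section \<open>Germs\<close>

definition same_germ :: "'a::linordered_ab_group_add set \<Rightarrow> 'a \<Rightarrow> 'a \<Rightarrow> bool" where
  "same_germ X p q \<longleftrightarrow> (\<exists>r>0. \<forall>t. near r t 0 \<longrightarrow> (p + t \<in> X \<longleftrightarrow> q + t \<in> X))"

lemma same_germ_sym: "same_germ X p q \<Longrightarrow> same_germ X q p"
  unfolding same_germ_def by metis

lemma same_germ_open:
  fixes X :: "'a::{linordered_ab_group_add, dense_linorder} set"
  assumes "same_germ X (z - y) (z - y')"
  shows "\<exists>s>0. \<forall>x. near s x z \<longrightarrow> same_germ X (x - y) (x - y')"
proof -
  from assms obtain r where r: "0 < r"
    "\<And>t. near r t 0 \<Longrightarrow> z - y + t \<in> X \<longleftrightarrow> z - y' + t \<in> X" unfolding same_germ_def by blast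
  obtain s where s: "0 < s" "s + s \<le> r" using ex_half[OF r(1)] by blast
  have "same_germ X (x - y) (x - y')" if "near s x z" for x
    unfolding same_germ_def
  proof (intro exI[of _ s] conjI allI impI s(1))
    fix t assume "near s t 0"
    moreover have "near s (x - z) 0" using that near_diff_0 by blast
    ultimately have "near (s + s) (x - z + t) 0"
      using near_trans[of s "x - z + t" "x - z" s 0] near_add_left[of s "x - z" t 0] by simp
    then have "near r (x - z + t) 0" using near_mono s(2) by blast
    from r(2)[OF this] show "x - y + t \<in> X \<longleftrightarrow> x - y' + t \<in> X" by (simp add: algebra_simps)
  qed
  with s(1) show ?thesis by blast
qed

context small_window
begin

lemma definable_same_germ:
  assumes X: "definable_pred (\<lambda>e. e 0 \<in> X)" and f: "definable_fun f" and g: "definable_fun g"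
  shows "definable_pred (\<lambda>e. same_germ X (f e) (g e))"
proof (rule definable_app2[OF _ f g])
  show "definable_pred (\<lambda>e. same_germ X (e 0) (e 1))"
    unfolding same_germ_def by (intro definable_intros definable_mem[OF X])
qed

text \<open>Assume that no such \<open>y\<close> exists. Then for each \<open>y\<close> the points where the translate by \<open>y\<close> has a germ
  different from all translates by \<open>F\<close> form a nowhere dense set \<open>B y\<close>, as agreement of germs is an
  open condition; hence \<open>B y\<close> is finite. So for each \<open>y\<close> all but finitely many terms of a
  fixed injective sequence \<open>z\<close> avoid \<open>B y\<close>. But for each \<open>z l\<close> only finitely many \<open>y\<close> put \<open>z l\<close>
  outside \<open>B y\<close>, because germ classes are finite, and countably many finite sets do not exhaust a
  ball.\<close>

lemma ex_shift_with_new_germs: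
  assumes X: "definable_pred (\<lambda>e. e 0 \<in> X)" and \<theta>: "\<theta> + \<theta> \<le> \<eta>"
    and fin: "\<And>q. finite {p. near \<eta> p w \<and> same_germ X p q}"
    and F: "finite F" and r: "0 < r" and ball: "\<And>z. near r z c \<Longrightarrow> near \<theta> z w"
  shows "\<exists>y c' r'. near \<theta> y 0 \<and> 0 < r' \<and>
     (\<forall>z. near r' z c' \<longrightarrow> near r z c \<and> (\<forall>y'\<in>F. \<not> same_germ X (z - y) (z - y')))"
proof (rule ccontr)
  assume contra: "\<not> ?thesis"
  have \<theta>0: "0 < \<theta>" using ball[of c] r near_pos near_refl by blast
  have "\<theta> \<le> \<eta>" using \<theta> \<theta>0 by (meson add_increasing less_imp_le order_refl order_trans le_add_same_cancel1)
  define B where "B y = {z. near r z c \<and> \<not> (\<exists>y'\<in>F. same_germ X (z - y) (z - y'))}" for y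
  have finite_B: "finite (B y)" if y: "near \<theta> y 0" for y
  proof (rule nowhere_dense_finite)
    show "definable_pred (\<lambda>e. e 0 \<in> B y)"
      unfolding B_def mem_Collect_eq
      by (intro definable_intros definable_finite_bex[OF F] definable_same_germ[OF X])
    show "near \<eta> z w" if "z \<in> B y" for z
      using that ball near_mono \<open>\<theta> \<le> \<eta>\<close> unfolding B_def by blast
    show "nowhere_dense (B y)" unfolding nowhere_dense_def
    proof (intro allI impI)
      fix c1 r1 :: 'a assume r1: "0 < r1"
      show "\<exists>x s. 0 < s \<and> (\<forall>z. near s z x \<longrightarrow> near r1 z c1 \<and> z \<notin> B y)"
      proof (cases "\<exists>x\<in>B y. near r1 x c1")
        case False
        then show ?thesis using r1 by blast
      next
        case True
        then obtain x where x: "near r x c" "near r1 x c1" unfolding B_def by blast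
        obtain s s1 where s: "0 < s" "\<And>z. near s z x \<Longrightarrow> near r z c"
          and s1: "0 < s1" "\<And>z. near s1 z x \<Longrightarrow> near r1 z c1"
          using near_interior[OF x(1)] near_interior[OF x(2)] by blast
        define s2 where "s2 = min s s1"
        have "s2 \<le> s" "s2 \<le> s1" by (simp_all add: s2_def)
        then have s2: "\<And>z. near s2 z x \<Longrightarrow> near r z c \<and> near r1 z c1"
          using s(2) s1(2) near_mono by blast
        have "0 < s2" using s(1) s1(1) by (simp add: s2_def)
        from contra y s2 \<open>0 < s2\<close> obtain z y' where z: "near s2 z x" "y' \<in> F" "same_germ X (z - y) (z - y')"
          by metis
        obtain s3 where s3: "0 < s3" "\<And>x. near s3 x z \<Longrightarrow> same_germ X (x - y) (x - y')"
          using same_germ_open[OF z(3)] by blast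
        have "near r1 z c1" using s2 z(1) by blast
        from near_interior[OF this] obtain s4 where
          s4: "0 < s4" "\<And>x. near s4 x z \<Longrightarrow> near r1 x c1" by blast
        have "near r1 v c1 \<and> v \<notin> B y" if "near (min s3 s4) v z" for v
        proof -
          have "near s3 v z" "near s4 v z" using that near_mono by (meson min.cobounded1 min.cobounded2)+
          then show ?thesis using s3(2) s4(2) z(2) unfolding B_def by blast
        qed
        then show ?thesis using s3(1) s4(1) by (intro exI[of _ z] exI[of _ "min s3 s4"]) simp
      qed
    qed
  qed
  obtain z :: "nat \<Rightarrow> 'a" where z: "inj z" "range z \<subseteq> {x. near r x c}"
    using infinite_countable_subset[OF infinite_ball[OF r]] by blast
  have zr: "near r (z l) c" for l using z(2) by auto
  have fin_z: "finite {y. near \<theta> y 0 \<and> (\<exists>y'\<in>F. same_germ X (z l - y) (z l - y'))}" for l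
  proof -
    have "finite {y. near \<theta> y 0 \<and> same_germ X (z l - y) (z l - y')}" for y'
    proof (rule finite_subset)
      show "{y. near \<theta> y 0 \<and> same_germ X (z l - y) (z l - y')} \<subseteq>
          (\<lambda>p. z l - p) ` {p. near \<eta> p w \<and> same_germ X p (z l - y')}"
      proof
        fix y assume "y \<in> {y. near \<theta> y 0 \<and> same_germ X (z l - y) (z l - y')}"
        then have y: "near \<theta> y 0" "same_germ X (z l - y) (z l - y')" by auto
        have "near \<theta> (z l - y) (z l)" using y(1) near_diff_left[of \<theta> "z l" y 0] by simp
        moreover have "near \<theta> (z l) w" using ball[OF zr] .
        ultimately have "near \<eta> (z l - y) w" using near_trans near_mono \<theta> by blast
        with y(2) show "y \<in> (\<lambda>p. z l - p) ` {p. near \<eta> p w \<and> same_germ X p (z l - y')}"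
          by (intro image_eqI[of _ _ "z l - y"]) auto
      qed
    qed (use fin in simp)
    then have "finite (\<Union>y'\<in>F. {y. near \<theta> y 0 \<and> same_germ X (z l - y) (z l - y')})"
      using F by blast
    then show ?thesis by (rule finite_subset[rotated]) blast
  qed
  have "countable (\<Union>l. {y. near \<theta> y 0 \<and> (\<exists>y'\<in>F. same_germ X (z l - y) (z l - y'))})"
    using fin_z by (auto intro: countable_UN countable_finite)
  from ex_near_not_in_countable[OF this \<theta>0, of 0] obtain y where
    y: "near \<theta> y 0" "\<And>l. \<not> (\<exists>y'\<in>F. same_germ X (z l - y) (z l - y'))" by blast
  have "range z \<subseteq> B y" using zr y(2) unfolding B_def by blast
  then have "finite (range z)" using finite_B[OF y(1)] finite_subset by blast
  then show False using z(1) finite_imageD infinite_UNIV_nat by blast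
qed

text \<open>A sequence of triples of a shift, a centre and a radius is built with
  \<open>ex_shift_with_new_germs\<close>. Its balls are nested and have a common subball by saturation, on
  which the germs of any two of the translates differ at every point. Germs that differ at every point of a
  ball make the symmetric difference dense there.\<close>

lemma shattering_if_finite_germ_classes:
  assumes X: "definable_pred (\<lambda>e. e 0 \<in> X)"
    and fin: "\<And>q. finite {p. near \<eta> p w \<and> same_germ X p q}"
  shows "\<exists>(a :: nat \<Rightarrow> 'a) b. \<forall>i<m. \<forall>S\<subseteq>{..<m}. a i + b S \<in> X \<longleftrightarrow> i \<in> S"
proof (rule ccontr)
  assume no_shatter: "\<not> ?thesis"
  \<comment> \<open>shifts and points are both bounded by \<open>\<theta>\<close>, so that shifted points remain in the window\<close>
  obtain \<theta> where \<theta>: "0 < \<theta>" "\<theta> + \<theta> \<le> \<eta>" using ex_half[OF pos] by blast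
  define P where "P f n v \<longleftrightarrow> (case v of (y, c, r) \<Rightarrow> near \<theta> y 0 \<and> 0 < r \<and>
      (\<forall>z. near r z c \<longrightarrow> near \<theta> z w \<and>
        (\<forall>m<n. near (snd (snd (f m))) z (fst (snd (f m))) \<and> \<not> same_germ X (z - y) (z - fst (f m)))))"
    for f :: "nat \<Rightarrow> 'a \<times> 'a \<times> 'a" and n v
  have "\<exists>f. \<forall>n. P f n (f n)"
  proof (rule dependent_wellorder_choice)
    fix v :: "'a \<times> 'a \<times> 'a" and f g :: "nat \<Rightarrow> 'a \<times> 'a \<times> 'a" and n
    assume "\<And>m. m < n \<Longrightarrow> f m = g m"
    then show "P f n v = P g n v" unfolding P_def by (simp cong: conj_cong)
  next
    fix n and f :: "nat \<Rightarrow> 'a \<times> 'a \<times> 'a"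
    assume IH: "\<And>m. m < n \<Longrightarrow> P f m (f m)"
    have "\<exists>c r. 0 < r \<and> (\<forall>z. near r z c \<longrightarrow> near \<theta> z w \<and>
        (\<forall>m<n. near (snd (snd (f m))) z (fst (snd (f m)))))"
    proof (cases n)
      case 0
      then show ?thesis using \<theta>(1) by blast
    next
      case (Suc k)
      obtain y c r where fk: "f k = (y, c, r)" by (cases "f k")
      have "P f k (y, c, r)" using IH[of k] Suc fk by simp
      then have "0 < r" "\<And>z. near r z c \<Longrightarrow> near \<theta> z w \<and>
        (\<forall>m<k. near (snd (snd (f m))) z (fst (snd (f m))))" unfolding P_def by auto
      then show ?thesis using Suc fk by (intro exI[of _ c] exI[of _ r]) (auto simp: less_Suc_eq)
    qed
    then obtain c r where r: "0 < r" "\<And>z. near r z c \<Longrightarrow> near \<theta> z w"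
      "\<And>z m. near r z c \<Longrightarrow> m < n \<Longrightarrow> near (snd (snd (f m))) z (fst (snd (f m)))" by blast
    obtain y c' r' where "near \<theta> y 0" "0 < r'"
      "\<And>z. near r' z c' \<Longrightarrow> near r z c \<and> (\<forall>y'\<in>(\<lambda>m. fst (f m)) ` {..<n}. \<not> same_germ X (z - y) (z - y'))"
      using ex_shift_with_new_germs[OF X \<theta>(2) fin _ r(1,2), of "(\<lambda>m. fst (f m)) ` {..<n}"] by blast
    then have "P f n (y, c', r')" unfolding P_def using r(2,3) by auto
    then show "\<exists>v. P f n v" by blast
  qed
  then obtain f where f: "\<And>n. P f n (f n)" by blast
  define y c r where "y n = fst (f n)" and "c n = fst (snd (f n))" and "r n = snd (snd (f n))" for n
  have f': "near \<theta> (y n) 0" "0 < r n" "\<And>z. near (r n) z (c n) \<Longrightarrow> near \<theta> z w"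
    "\<And>m z. m < n \<Longrightarrow> near (r n) z (c n) \<Longrightarrow> near (r m) z (c m) \<and> \<not> same_germ X (z - y n) (z - y m)" for n
    using f[of n] by (auto simp: P_def y_def c_def r_def split: prod.splits)
  obtain s x where s: "0 < s" "\<And>n z. near s z x \<Longrightarrow> near (r n) z (c n)"
    using ex_ball_in_nested_balls[of r c] f'(2,4) by blast
  have differ: "\<not> same_germ X (z - y i) (z - y j)" if "near s z x" "i < j" for z i j
    using f'(4)[OF that(2), of z] s(2)[OF that(1)] same_germ_sym by blast
  have "\<exists>T\<subseteq>{..<m}. \<forall>x. \<exists>i<m. (x - y (e i) \<in> X) \<noteq> (i \<in> T)" for e :: "nat \<Rightarrow> nat"
  proof (rule ccontr)
    assume contra: "\<not> ?thesis"
    have "\<forall>T. \<exists>x. T \<subseteq> {..<m} \<longrightarrow> (\<forall>i<m. x - y (e i) \<in> X \<longleftrightarrow> i \<in> T)"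
    proof (rule allI, rule ccontr)
      fix T assume "\<not> (\<exists>x. T \<subseteq> {..<m} \<longrightarrow> (\<forall>i<m. x - y (e i) \<in> X \<longleftrightarrow> i \<in> T))"
      then have "T \<subseteq> {..<m} \<and> (\<forall>x. \<exists>i<m. (x - y (e i) \<in> X) \<noteq> (i \<in> T))" by simp
      then have "\<exists>T\<subseteq>{..<m}. \<forall>x. \<exists>i<m. (x - y (e i) \<in> X) \<noteq> (i \<in> T)" by (rule exI)
      with contra show False by (rule notE)
    qed
    from choice[OF this] obtain b where
      "\<forall>T. T \<subseteq> {..<m} \<longrightarrow> (\<forall>i<m. b T - y (e i) \<in> X \<longleftrightarrow> i \<in> T)" ..
    then have "\<forall>i<m. \<forall>S\<subseteq>{..<m}. - y (e i) + b S \<in> X \<longleftrightarrow> i \<in> S" by simp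
    then have "\<exists>(a :: nat \<Rightarrow> 'a) b. \<forall>i<m. \<forall>S\<subseteq>{..<m}. a i + b S \<in> X \<longleftrightarrow> i \<in> S"
      by (intro exI[of _ "\<lambda>i. - y (e i)"] exI[of _ b])
    with no_shatter show False by (rule notE)
  qed
  then obtain h :: "nat \<Rightarrow> nat" where h: "strict_mono h"
    "\<And>J x. card J = m \<Longrightarrow> \<exists>j\<in>J. (x - y (h (2 * j)) \<in> X) = (x - y (h (2 * j + 1)) \<in> X)"
    using no_frequent_alternation[where A = "\<lambda>n x. x - y n \<in> X" and m = m] by metis
  have m: "0 < m" using no_shatter by (cases m) auto
  define Q where "Q z a b \<longleftrightarrow> (z - a \<in> X) \<noteq> (z - b \<in> X)" for z a b
  have "definable_pred (\<lambda>e. Q (e 0) (e 1) (e 2))" unfolding Q_def by (intro definable_intros definable_mem[OF X])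
  then show False
  proof (rule no_dense_row[where w = w and k = m and r = s and c = x and
        a = "\<lambda>j. y (h (2 * j))" and b = "\<lambda>j. y (h (2 * j + 1))"])
    show "\<exists>j\<in>J. \<not> Q z (y (h (2 * j))) (y (h (2 * j + 1)))" if "card J = m" for J z
      using h(2)[OF that] unfolding Q_def by blast
    show "near \<eta> z w" if "near s z x" for z
    proof -
      have "near \<theta> z w" using f'(3)[of 0] s(2)[OF that] by blast
      moreover have "\<theta> \<le> \<eta>" using \<theta> by (meson less_imp_le order_trans le_add_same_cancel1)
      ultimately show ?thesis using near_mono by blast
    qed
    fix j
    show "dense_in {z. Q z (y (h (2 * j))) (y (h (2 * j + 1)))} x s" unfolding dense_in_def
    proof (intro allI impI)
      fix z t :: 'a assume z: "near s z x" and t: "0 < t"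
      have "h (2 * j) < h (2 * j + 1)" using h(1) by (simp add: strict_mono_less)
      from differ[OF z this] t obtain u where u: "near t u 0"
        "(z - y (h (2 * j)) + u \<in> X) \<noteq> (z - y (h (2 * j + 1)) + u \<in> X)"
        unfolding same_germ_def by blast
      then have "Q (z + u) (y (h (2 * j))) (y (h (2 * j + 1)))"
        by (simp add: Q_def algebra_simps)
      moreover have "near t (z + u) z" using u(1) near_add_left[of t z u 0] by simp
      ultimately show "\<exists>v\<in>{z. Q z (y (h (2 * j))) (y (h (2 * j + 1)))}. near t v z" by blast
    qed
  qed (use m s(1) in auto)
qed

end

section \<open>Local periods\<close>

text \<open>The radius \<open>r\<close> limits where the period is tested. It shrinks whenever periods are added, which
  is why the periods form only a local subgroup.\<close>

definition period :: "'a::linordered_ab_group_add set \<Rightarrow> 'a \<Rightarrow> 'a \<Rightarrow> 'a \<Rightarrow> bool" where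
  "period X a r s \<longleftrightarrow> (\<forall>t. near r t 0 \<longrightarrow> (a + s + t \<in> X \<longleftrightarrow> a + t \<in> X))"

lemma period_mono: "period X a r s \<Longrightarrow> r' \<le> r \<Longrightarrow> period X a r' s"
  unfolding period_def using near_mono by blast

lemma period_diff:
  assumes "period X a r s" "period X a r s'" "near \<delta> s' 0" "\<rho> + \<delta> \<le> r"
  shows "period X a \<rho> (s - s')"
  unfolding period_def
proof (intro allI impI)
  fix t assume "near \<rho> t 0"
  then have "near r (t - s') 0" using near_diff[OF _ assms(3)] near_mono assms(4) by blast
  then have "a + s + (t - s') \<in> X \<longleftrightarrow> a + s' + (t - s') \<in> X"
    using assms(1,2) unfolding period_def by blast
  then show "a + (s - s') + t \<in> X \<longleftrightarrow> a + t \<in> X" by (simp add: algebra_simps)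
qed

lemma period_multiple:
  assumes "period X a (\<rho> + \<rho>) s" "\<And>j. j \<le> k \<Longrightarrow> near \<rho> (multiple j s) 0"
  shows "period X a \<rho> (multiple k s)"
  using assms(2)
proof (induction k)
  case 0
  then show ?case by (simp add: period_def)
next
  case (Suc k)
  have IH: "period X a \<rho> (multiple k s)" using Suc by simp
  show ?case unfolding period_def
  proof (intro allI impI)
    fix t assume t: "near \<rho> t 0"
    have "near (\<rho> + \<rho>) (multiple k s + t) 0" using near_add[OF Suc.prems[of k] t] by simp
    then have "a + s + (multiple k s + t) \<in> X \<longleftrightarrow> a + (multiple k s + t) \<in> X"
      using assms(1) unfolding period_def by blast
    also have "\<dots> \<longleftrightarrow> a + t \<in> X" using IH t unfolding period_def by (simp add: add.assoc)
    finally show "a + multiple (Suc k) s + t \<in> X \<longleftrightarrow> a + t \<in> X" by (simp add: algebra_simps)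
  qed
qed

text \<open>Local form of the fact that a divisible group has no proper subgroup of finite index. With
  \<open>N\<close> cosets, two of the multiples \<open>0, \<tau>, \<dots>, N\<tau>\<close> of \<open>\<tau> = y / N!\<close> lie in the same one. Their difference
  \<open>r\<tau>\<close> with \<open>0 < r \<le> N\<close> is a period, and so is its multiple \<open>y\<close>, as \<open>r\<close> divides \<open>N!\<close>. All
  intermediate multiples stay between \<open>0\<close> and \<open>y\<close>, so that the radius is not exhausted.\<close>

lemma period_if_finitely_many_cosets:
  fixes X :: "'a::linordered_ab_group_add set"
  assumes div: "divisible_group TYPE('a)" and F: "finite F" "\<And>y. y \<in> F \<Longrightarrow> near \<theta> y 0"
    and cover: "\<And>y. near \<theta> y 0 \<Longrightarrow> \<exists>y'\<in>F. period X a \<kappa> (y' - y)"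
    and \<kappa>: "\<mu> + (\<theta> + \<theta>) \<le> \<kappa>" and \<nu>: "\<nu> + \<nu> \<le> \<mu>" "\<nu> \<le> \<theta>" and y: "near \<nu> y 0"
  shows "period X a \<nu> y"
proof -
  define N where "N = card F"
  have "fact N > (0::nat)" by simp
  then obtain \<tau> where \<tau>: "multiple (fact N) \<tau> = y"
    using div unfolding divisible_group_def multiple_def by blast
  have near_\<tau>: "near \<nu> (multiple k \<tau>) 0" if "k \<le> fact N" for k
    using near_multiple_mono[of \<nu> "fact N" \<tau> k] y \<tau> that by simp
  have le: "k \<le> fact N" if "k \<le> N" for k using that fact_ge_self[of N] by linarith
  have "\<forall>k\<in>{..N}. \<exists>y'\<in>F. period X a \<kappa> (y' - multiple k \<tau>)"
    using cover near_\<tau> le near_mono \<nu>(2) by blast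
  then obtain g where g: "\<And>k. k \<le> N \<Longrightarrow> g k \<in> F" "\<And>k. k \<le> N \<Longrightarrow> period X a \<kappa> (g k - multiple k \<tau>)"
    by (metis atMost_iff)
  have "\<not> inj_on g {..N}"
  proof
    assume "inj_on g {..N}"
    then have "card {..N} \<le> card F" by (rule card_inj_on_le) (use g(1) F(1) in auto)
    then show False by (simp add: N_def)
  qed
  then obtain k k' where k: "k < k'" "k' \<le> N" "g k = g k'"
    unfolding inj_on_def by (metis atMost_iff linorder_neqE_nat)
  define r where "r = k' - k"
  have r: "0 < r" "r \<le> N" "k' = k + r" using k by (auto simp: r_def)
  have close: "near (\<theta> + \<theta>) (g k' - multiple k' \<tau>) 0"
    using near_diff F(2)[OF g(1)[OF k(2)]] near_mono[OF near_\<tau>[OF le[OF k(2)]] \<nu>(2)] by blast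
  have "k \<le> N" using k by simp
  from period_diff[OF g(2)[OF this] g(2)[OF k(2)] close \<kappa>]
  have "period X a \<mu> ((g k - multiple k \<tau>) - (g k' - multiple k' \<tau>))" .
  moreover have "(g k - multiple k \<tau>) - (g k' - multiple k' \<tau>) = multiple r \<tau>"
    using k(3) r(3) by (simp add: multiple_add algebra_simps)
  ultimately have per: "period X a (\<nu> + \<nu>) (multiple r \<tau>)" using period_mono \<nu>(1) by simp
  have "r dvd fact N" using r(1,2) by (simp add: dvd_fact)
  then obtain m where m: "fact N = m * r" by (metis dvd_def mult.commute)
  have "near \<nu> (multiple j (multiple r \<tau>)) 0" if "j \<le> m" for j
    using near_\<tau>[of "j * r"] m that by (simp add: multiple_mult)
  from period_multiple[OF per this] have "period X a \<nu> (multiple m (multiple r \<tau>))" by simp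
  then show ?thesis using \<tau> m by (simp add: multiple_mult)
qed

section \<open>Germ classes are finite\<close>

context small_window
begin

text \<open>In an infinite class, infinitely many points agree with \<open>q\<close> on a common radius \<open>\<rho>\<close>, and these
  are dense in some ball. Fix one of them, \<open>a\<close>. The differences to \<open>a\<close> are periods
  of \<open>X\<close> around \<open>a\<close>, dense near \<open>0\<close>. Shifts \<open>y n\<close> in pairwise different cosets of the periods exist
  by \<open>period_if_finitely_many_cosets\<close>, because a point of \<open>X\<close> and a point outside \<open>X\<close> that are both
  close to \<open>a\<close> differ by an element that is not a period. The cosets form a forbidden row of dense sets.\<close>

lemma finite_germ_classes:
  assumes div: "divisible_group TYPE('a)" and X: "definable_pred (\<lambda>e. e 0 \<in> X)"
    and dense: "\<And>x s. near \<eta> x w \<Longrightarrow> 0 < s \<Longrightarrow> \<exists>y\<in>X. near s y x"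
    and codense: "\<And>x s. near \<eta> x w \<Longrightarrow> 0 < s \<Longrightarrow> \<exists>y. y \<notin> X \<and> near s y x"
  shows "finite {p. near \<eta> p w \<and> same_germ X p q}"
proof (rule ccontr)
  assume "infinite {p. near \<eta> p w \<and> same_germ X p q}"
  then obtain p :: "nat \<Rightarrow> 'a" where p: "inj p" "range p \<subseteq> {p. near \<eta> p w \<and> same_germ X p q}"
    using infinite_countable_subset by blast
  then have "\<forall>n. \<exists>r>0. \<forall>t. near r t 0 \<longrightarrow> (p n + t \<in> X \<longleftrightarrow> q + t \<in> X)"
    unfolding same_germ_def by blast
  then obtain r where r: "\<And>n. 0 < r n"
    "\<And>n t. near (r n) t 0 \<Longrightarrow> p n + t \<in> X \<longleftrightarrow> q + t \<in> X" by metis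
  obtain \<rho> where \<rho>: "0 < \<rho>" "\<And>n. \<rho> < r n" using ex_pos_below[of r] r(1) by blast
  define A where "A = {p. near \<eta> p w \<and> (\<forall>t. near \<rho> t 0 \<longrightarrow> (p + t \<in> X \<longleftrightarrow> q + t \<in> X))}"
  have "p n \<in> A" for n
    using p(2) r(2)[of n] near_mono[OF _ less_imp_le[OF \<rho>(2)[of n]]] unfolding A_def by blast
  then have "infinite A" using p(1) by (meson finite_subset finite_imageD image_subset_iff infinite_UNIV_nat)
  moreover have "definable_pred (\<lambda>e. e 0 \<in> A)"
    unfolding A_def mem_Collect_eq by (intro definable_intros definable_mem[OF X])
  ultimately have "\<not> nowhere_dense A" using nowhere_dense_finite[of A w] unfolding A_def by blast
  then obtain c r0 where c: "0 < r0" "dense_in A c r0" by (rule not_nowhere_denseD)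
  from c obtain a where a: "a \<in> A" "near r0 a c" unfolding dense_in_def by (metis near_refl)
  from near_interior[OF a(2)] obtain \<sigma> where \<sigma>: "0 < \<sigma>" "\<And>z. near \<sigma> z a \<Longrightarrow> near r0 z c" by blast
  have dense_period: "\<exists>u. near s u x \<and> period X a \<rho> u" if x: "near \<sigma> x 0" and s: "0 < s" for x s
  proof -
    have "near r0 (a + x) c" using \<sigma>(2)[of "a + x"] near_add_left[of \<sigma> a x 0] x by simp
    then obtain b where b: "b \<in> A" "near s b (a + x)" using c(2) s unfolding dense_in_def by blast
    have "near s (b - a) x" using near_add_left[of s a "b - a" x] b(2) by simp
    moreover have "period X a \<rho> (b - a)" using a(1) b(1) unfolding A_def period_def by simp
    ultimately show ?thesis by blast
  qed
  have aw: "near \<eta> a w" using a(1) by (simp add: A_def)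
  \<comment> \<open>each halving pays for one loss of radius: from \<open>\<rho>\<close> to \<open>\<kappa>\<close> when two overlapping cosets are compared,
    from \<open>\<kappa>\<close> to \<open>\<mu>\<close> for the difference of two periods that the pigeonhole argument yields, and
    from \<open>\<mu>\<close> to \<open>\<theta>\<close> for its multiples\<close>
  have "0 < min (min \<rho> \<sigma>) \<eta>" using \<rho>(1) \<sigma>(1) pos by simp
  then obtain \<kappa> where \<kappa>: "0 < \<kappa>" "\<kappa> + \<kappa> \<le> min (min \<rho> \<sigma>) \<eta>" using ex_half by blast
  obtain \<mu> where \<mu>: "0 < \<mu>" "\<mu> + \<mu> \<le> \<kappa>" using ex_half[OF \<kappa>(1)] by blast
  obtain \<theta> where \<theta>: "0 < \<theta>" "\<theta> + \<theta> \<le> \<mu>" using ex_half[OF \<mu>(1)] by blast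
  have le: "\<theta> \<le> \<mu>" "\<mu> \<le> \<kappa>" "\<kappa> \<le> \<rho>" "\<kappa> \<le> \<sigma>" "\<kappa> \<le> \<eta>"
    using \<kappa> \<mu> \<theta> by (auto intro: le_if_double_le)
  have new: "\<exists>y. near \<theta> y 0 \<and> (\<forall>y'\<in>F. \<not> period X a \<kappa> (y' - y))"
    if F: "finite F" "\<And>y. y \<in> F \<Longrightarrow> near \<theta> y 0" for F
  proof (rule ccontr)
    assume "\<not> ?thesis"
    then have cover: "\<exists>y'\<in>F. period X a \<kappa> (y' - y)" if "near \<theta> y 0" for y using that by blast
    \<comment> \<open>then all elements of size \<open>\<theta>\<close> are periods, also one that leads from \<open>X\<close> out of \<open>X\<close>\<close>
    have 1: "\<mu> + (\<theta> + \<theta>) \<le> \<kappa>" using \<mu>(2) \<theta>(2) by (meson add_left_mono order_trans)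
    have period: "period X a \<theta> y" if "near \<theta> y 0" for y
      using period_if_finitely_many_cosets[OF div F cover 1 \<theta>(2) order_refl that] .
    obtain \<nu> where \<nu>: "0 < \<nu>" "\<nu> + \<nu> \<le> \<theta>" using ex_half[OF \<theta>(1)] by blast
    obtain x where x: "x \<in> X" "near \<nu> x a" using dense[OF aw \<nu>(1)] by blast
    obtain x' where x': "x' \<notin> X" "near \<nu> x' a" using codense[OF aw \<nu>(1)] by blast
    have "near \<nu> (x - a) 0" "near \<nu> (x' - a) 0" using x(2) x'(2) near_diff_0 by blast+
    then have "near \<theta> ((x' - a) - (x - a)) 0" using near_diff near_mono \<nu>(2) by blast
    then have "period X a \<theta> (x' - x)" using period by simp
    moreover have "near \<theta> (x - a) 0"
      using near_mono[OF \<open>near \<nu> (x - a) 0\<close> le_if_double_le[OF \<nu>]] .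
    ultimately have "a + (x' - x) + (x - a) \<in> X \<longleftrightarrow> a + (x - a) \<in> X" unfolding period_def by blast
    then show False using x(1) x'(1) by simp
  qed
  define P where "P f n y \<longleftrightarrow> near \<theta> y 0 \<and> (\<forall>m<n. \<not> period X a \<kappa> (f m - y))"
    for f :: "nat \<Rightarrow> 'a" and n y
  have "\<exists>f. \<forall>n. P f n (f n)"
  proof (rule dependent_wellorder_choice)
    fix v :: 'a and f g :: "nat \<Rightarrow> 'a" and n
    assume "\<And>m. m < n \<Longrightarrow> f m = g m"
    then show "P f n v = P g n v" unfolding P_def by simp
  next
    fix n and f :: "nat \<Rightarrow> 'a"
    assume "\<And>m. m < n \<Longrightarrow> P f m (f m)"
    then show "\<exists>v. P f n v" using new[of "f ` {..<n}"] unfolding P_def by blast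
  qed
  then obtain y :: "nat \<Rightarrow> 'a" where y: "\<And>n. near \<theta> (y n) 0" "\<And>m n. m < n \<Longrightarrow> \<not> period X a \<kappa> (y m - y n)"
    unfolding P_def by blast
  define Q where "Q z b b' \<longleftrightarrow> near \<theta> z 0 \<and> period X a \<rho> (z - b)" for z b b' :: 'a
  have definable_Q: "definable_pred (\<lambda>e. Q (e 0) (e 1) (e 2))"
    unfolding Q_def period_def by (intro definable_intros definable_mem[OF X])
  have disjoint: False if "i < j" "Q z (y i) (y i)" "Q z (y j) (y j)" for i j z
  proof -
    have "near (\<theta> + \<theta>) (z - y i) 0" using near_diff[OF _ y(1)] that(2) unfolding Q_def by blast
    then have close: "near \<kappa> (z - y i) 0" using \<theta>(2) le(2) near_mono order_trans by blast
    have "\<kappa> + \<kappa> \<le> \<rho>" using \<kappa>(2) by simp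
    from period_diff[OF _ _ close this, of X a "z - y j"]
    have "period X a \<kappa> ((z - y j) - (z - y i))" using that(2,3) unfolding Q_def by blast
    then show False using y(2)[OF that(1)] by simp
  qed
  have two: "\<exists>j\<in>J. \<not> Q z (y j) (y j)" if "card J = 2" for J z
    using that disjoint unfolding card_2_iff by (metis insertCI linorder_neqE_nat)
  show False
  proof (rule no_dense_row[where w = 0 and k = 2 and r = \<theta> and c = 0 and a = y and b = y, OF definable_Q])
    show "near \<eta> z 0" if "near \<theta> z 0" for z using that near_mono le by (meson order_trans)
    fix j
    show "dense_in {z. Q z (y j) (y j)} 0 \<theta>" unfolding dense_in_def
    proof (intro allI impI)
      fix x s :: 'a assume x: "near \<theta> x 0" and s: "0 < s"
      obtain t where t: "0 < t" "\<And>z. near t z x \<Longrightarrow> near \<theta> z 0" using near_interior[OF x] by blast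
      have "near (\<theta> + \<theta>) (x - y j) 0" using near_diff[OF x y(1)] .
      then have "near \<sigma> (x - y j) 0" using \<theta>(2) le near_mono by (meson order_trans)
      from dense_period[OF this, of "min s t"] s t(1) obtain u where
        u: "near (min s t) u (x - y j)" "period X a \<rho> u" by auto
      have "near (min s t) (u + y j) x" using near_add_right[of "min s t" u "y j" "x - y j"] u(1) by simp
      then have "near s (u + y j) x" "near t (u + y j) x" using near_mono by (meson min.cobounded1 min.cobounded2)+
      then have "Q (u + y j) (y j) (y j)" using t(2) u(2) unfolding Q_def by simp
      then show "\<exists>v\<in>{z. Q z (y j) (y j)}. near s v x" using \<open>near s (u + y j) x\<close> by blast
    qed
  qed (use two \<theta>(1) in auto)
qed

end

section \<open>From the hypotheses to a small window\<close>

context saturated_structure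
begin

text \<open>The isolation radii of countably many points of \<open>D\<close> have a common lower bound \<open>\<rho>\<close>. The points of
  \<open>D\<close> that are isolated with radius \<open>\<rho>\<close> are therefore still infinitely many.\<close>

lemma ex_small_window:
  assumes burden: "burden_less L R 1 {Eq (Var 0) (Var 0)} 3"
    and D: "definable_pred (\<lambda>e. e 0 \<in> D)" "infinite D" "discrete D" and \<epsilon>: "0 < \<epsilon>"
  obtains D' \<eta> where "small_window L R lt pl D' \<eta>" "\<eta> \<le> \<epsilon>"
proof -
  obtain d :: "nat \<Rightarrow> 'a" where d: "inj d" "range d \<subseteq> D"
    using infinite_countable_subset[OF D(2)] by blast
  have "\<exists>r>0. \<forall>x\<in>D. near r x y \<longrightarrow> x = y" if y: "y \<in> D" for y
  proof -
    obtain T where T: "open T" "T \<inter> D = {y}"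
      using D(3) y unfolding discrete_def isolated_in_def by blast
    then have "y \<in> T" by blast
    have "y < y + \<epsilon>" "y - \<epsilon> < y" using \<epsilon> by auto
    then obtain u v where u: "y < u" "{y..<u} \<subseteq> T" and v: "v < y" "{v<..y} \<subseteq> T"
      using open_right[OF T(1) \<open>y \<in> T\<close>] open_left[OF T(1) \<open>y \<in> T\<close>] by metis
    define r where "r = min (u - y) (y - v)"
    have "x = y" if "x \<in> D" "near r x y" for x
    proof -
      have "x < y + r" "y < x + r" using that(2) by (auto simp: near_def)
      moreover have "r \<le> u - y" "r \<le> y - v" by (simp_all add: r_def)
      then have "y + r \<le> u" "x + r \<le> x + (y - v)"
        by (simp_all only: le_diff_eq add.commute[of y r] add_left_mono)
      ultimately have "x < u" "y < x + (y - v)" by (blast intro: less_le_trans)+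
      then have "x < u" "v < x" by (simp_all add: algebra_simps)
      then have "x \<in> T" using u(2) v(2) by (metis atLeastLessThan_iff greaterThanAtMost_iff linear subsetD)
      then show ?thesis using T(2) that(1) by blast
    qed
    moreover have "0 < r" using u(1) v(1) by (simp add: r_def)
    ultimately show ?thesis by blast
  qed
  then have "\<forall>n. \<exists>r>0. \<forall>x\<in>D. near r x (d n) \<longrightarrow> x = d n" using d(2) by blast
  then obtain r where r: "\<And>n. 0 < r n" "\<And>n x. x \<in> D \<Longrightarrow> near (r n) x (d n) \<Longrightarrow> x = d n" by metis
  obtain \<rho> where \<rho>: "0 < \<rho>" "\<And>n. \<rho> < r n" using ex_pos_below[of r] r(1) by blast
  define D' where "D' = {y. y \<in> D \<and> (\<forall>x\<in>D. near \<rho> x y \<longrightarrow> x = y)}"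
  have "d n \<in> D'" for n
    using d(2) r(2)[of _ n] near_mono[OF _ less_imp_le[OF \<rho>(2)[of n]]] unfolding D'_def by blast
  then have "infinite D'" using d(1) by (meson finite_subset finite_imageD image_subset_iff infinite_UNIV_nat)
  moreover have "definable_pred (\<lambda>e. e 0 \<in> D')"
    unfolding D'_def mem_Collect_eq by (intro definable_intros D(1))
  moreover obtain \<eta> where \<eta>: "0 < \<eta>" "\<eta> + \<eta> \<le> min \<rho> \<epsilon>" using ex_half[of "min \<rho> \<epsilon>"] \<rho>(1) \<epsilon> by auto
  moreover have "y = y'" if "y \<in> D'" "y' \<in> D'" "near \<eta> z y" "near \<eta> z y'" for z y y'
  proof -
    have "near (\<eta> + \<eta>) y y'" using near_trans that(3,4) near_sym by blast
    then have "near \<rho> y y'" using near_mono \<eta>(2) by (metis min.boundedE)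
    then show ?thesis using that(1,2) unfolding D'_def by blast
  qed
  ultimately have "small_window L R lt pl D' \<eta>"
    by unfold_locales (use burden in auto)
  moreover have "\<eta> \<le> \<epsilon>" using le_if_double_le[OF \<eta>] by simp
  ultimately show ?thesis by (rule that)
qed

end

lemma dense_codense_ball:
  fixes X :: "'a::{linordered_ab_group_add, linorder_topology, dense_linorder} set"
  assumes "{u<..<v} \<noteq> {}" "dense_codense_in X {u<..<v}"
  obtains w \<epsilon> where "0 < \<epsilon>" "\<And>x s. near \<epsilon> x w \<Longrightarrow> 0 < s \<Longrightarrow> \<exists>y\<in>X. near s y x"
    "\<And>x s. near \<epsilon> x w \<Longrightarrow> 0 < s \<Longrightarrow> \<exists>y. y \<notin> X \<and> near s y x"
proof -
  obtain w where w: "u < w" "w < v" using assms(1) by (metis equals0I greaterThanLessThan_iff)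
  define \<epsilon> where "\<epsilon> = min (v - w) (w - u)"
  have \<epsilon>: "0 < \<epsilon>" using w by (simp add: \<epsilon>_def)
  have ball: "x \<in> {u<..<v}" if "near \<epsilon> x w" for x
  proof -
    have "x < w + \<epsilon>" "w < x + \<epsilon>" using that by (auto simp: near_def)
    moreover have "\<epsilon> \<le> v - w" "\<epsilon> \<le> w - u" by (simp_all add: \<epsilon>_def)
    then have "w + \<epsilon> \<le> v" "x + \<epsilon> \<le> x + (w - u)"
      by (simp_all only: le_diff_eq add.commute[of w \<epsilon>] add_left_mono)
    ultimately have "x < v" "w < x + (w - u)" by (blast intro: less_le_trans)+
    then show ?thesis by (simp add: algebra_simps)
  qed
  have meets: "\<exists>y\<in>S. near s y x" if "x \<in> closure S" "0 < s" for S and x s :: 'a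
  proof -
    have "open {x - s<..<x + s}" "x \<in> {x - s<..<x + s}" using that(2) by auto
    then have "{x - s<..<x + s} \<inter> S \<noteq> {}"
      using that(1) open_Int_closure_eq_empty[of "{x - s<..<x + s}" S] by blast
    then show ?thesis by (auto simp: near_def algebra_simps)
  qed
  have closures: "{u<..<v} \<subseteq> closure (X \<inter> {u<..<v})" "{u<..<v} \<subseteq> closure ({u<..<v} - X)"
    using assms(2) by (auto simp: dense_codense_in_def)
  show ?thesis
  proof (rule that[OF \<epsilon>])
    fix x s :: 'a assume "near \<epsilon> x w" "0 < s"
    then show "\<exists>y\<in>X. near s y x" "\<exists>y. y \<notin> X \<and> near s y x"
      using meets[of x "X \<inter> {u<..<v}" s] meets[of x "{u<..<v} - X" s] ball closures by blast+
  qed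
qed

section \<open>The independence property for translates\<close>

theorem theorem2p26:
  fixes L :: "('f, 'r) lang"
    and R :: "('f, 'r, 'a::{linordered_ab_group_add, linorder_topology, dense_linorder}) struct"
    and lt :: 'r and pl :: 'f and D X :: "'a set"
  assumes "expands_ordered_group L R lt pl"
    and "divisible_group TYPE('a)"
    and "saturated L R (cardSuc (card_of (Th L R)))"
    and "struct_burden_eq L R 2"
    and "definable_set L R D" and "infinite D" and "discrete D"
    and "definable_set L R X"
    and "\<exists>u v. {u<..<v} \<noteq> {} \<and> dense_codense_in X {u<..<v}"
  shows "definable L R 2 {[x, y] | x y. x + y \<in> X} \<and>
    (\<forall>\<phi> cs. defines_rel L R 2 \<phi> cs {[x, y] | x y. x + y \<in> X} \<longrightarrow>
       independence_property R 1 1 \<phi> cs)"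
proof -
  interpret saturated_structure L R lt pl
    using assms(1,3) by unfold_locales
  have X: "definable_pred (\<lambda>e. e 0 \<in> X)" and D: "definable_pred (\<lambda>e. e 0 \<in> D)"
    using assms(5,8) definable_set_imp_pred by blast+
  have burden: "burden_less L R 1 {Eq (Var 0) (Var 0)} 3"
    using assms(4) by (simp add: struct_burden_eq_def burden_eq_def numeral_3_eq_3 numeral_2_eq_2)
  obtain w \<epsilon> where \<epsilon>: "0 < \<epsilon>" "\<And>x s. near \<epsilon> x w \<Longrightarrow> 0 < s \<Longrightarrow> \<exists>y\<in>X. near s y x"
    "\<And>x s. near \<epsilon> x w \<Longrightarrow> 0 < s \<Longrightarrow> \<exists>y. y \<notin> X \<and> near s y x"
    using dense_codense_ball assms(9) by metis
  obtain D' \<eta> where "small_window L R lt pl D' \<eta>" and \<eta>: "\<eta> \<le> \<epsilon>"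
    using ex_small_window[OF burden D assms(6,7) \<epsilon>(1)] .
  then interpret small_window L R lt pl D' \<eta> by simp
  have "finite {p. near \<eta> p w \<and> same_germ X p q}" for q
    using finite_germ_classes[OF assms(2) X] \<epsilon>(2,3) \<eta> near_mono by blast
  then have shatter: "\<exists>(a :: nat \<Rightarrow> 'a) b. \<forall>i<m. \<forall>S\<subseteq>{..<m}. a i + b S \<in> X \<longleftrightarrow> i \<in> S" for m
    by (rule shattering_if_finite_germ_classes[OF X])
  have sum: "definable_pred (\<lambda>e. e 0 + e 1 \<in> X)" by (intro definable_intros definable_mem[OF X])
  obtain \<phi> cs where \<phi>: "\<phi> \<in> formulas L (2 + length cs)"
    "\<And>xs. length xs = 2 \<Longrightarrow> holds R \<phi> (xs @ cs) \<longleftrightarrow> xs ! 0 + xs ! 1 \<in> X"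
    using definable_pred_formula[OF sum, of 2] by auto
  have "{[x, y] | x y. x + y \<in> X} = {xs \<in> tuples (univ R) 2. holds R \<phi> (xs @ cs)}"
  proof (intro set_eqI iffI)
    fix xs assume "xs \<in> {[x, y] | x y. x + y \<in> X}"
    then show "xs \<in> {xs \<in> tuples (univ R) 2. holds R \<phi> (xs @ cs)}"
      using \<phi>(2)[of xs] by (auto simp: tuples_def)
  next
    fix xs assume xs: "xs \<in> {xs \<in> tuples (univ R) 2. holds R \<phi> (xs @ cs)}"
    then obtain x y where "xs = [x, y]"
      by (auto simp: tuples_def numeral_2_eq_2 length_Suc_conv)
    then show "xs \<in> {[x, y] | x y. x + y \<in> X}" using xs \<phi>(2)[of xs] by simp
  qed
  then have "definable L R 2 {[x, y] | x y. x + y \<in> X}"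
    unfolding definable_def defines_rel_def param_formulas_def using \<phi>(1) by auto
  moreover have "independence_property R 1 1 \<phi> cs"
    if def: "defines_rel L R 2 \<phi> cs {[x, y] | x y. x + y \<in> X}" for \<phi> cs
    unfolding independence_property_def
  proof
    fix l :: nat
    have holds_iff: "holds R \<phi> (x # y # cs) \<longleftrightarrow> x + y \<in> X" for x y
    proof -
      have "[x, y] \<in> {[x, y] | x y. x + y \<in> X} \<longleftrightarrow> holds R \<phi> ([x, y] @ cs)"
        using def unfolding defines_rel_def by (auto simp: tuples_def)
      then show ?thesis by simp
    qed
    from shatter[of l] obtain a :: "nat \<Rightarrow> 'a" and b where
      ab: "\<forall>i<l. \<forall>S\<subseteq>{..<l}. a i + b S \<in> X \<longleftrightarrow> i \<in> S"
      by (elim exE) (rule that)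
    show "\<exists>a b. (\<forall>i<l. a i \<in> tuples (univ R) 1) \<and> (\<forall>S\<subseteq>{..<l}. b S \<in> tuples (univ R) 1) \<and>
        (\<forall>i<l. \<forall>S\<subseteq>{..<l}. holds R \<phi> (a i @ b S @ cs) \<longleftrightarrow> i \<in> S)"
      by (rule exI[of _ "\<lambda>i. [a i]"], rule exI[of _ "\<lambda>S. [b S]"])
        (use ab in \<open>simp add: holds_iff tuples_def\<close>)
  qed
  ultimately show ?thesis by blast
qed

end
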